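(* For every integer $n\ge0$, $$2^n\mu_n(a,b,c,d;q) = \sum_{\alpha,\beta,\gamma,\delta\ge0}a^\alpha b^\beta c^\gamma d^\delta\; \overline P(n,\alpha+\beta+\gamma+\delta) \begin{bmatrix} \alpha+\beta+\gamma+\delta\\ \alpha,\beta,\gamma,\delta\end{bmatrix}_q \frac{(ad)_{\beta+\gamma}(ac)_{\beta}(bd)_{\gamma}}{(abcd)_{\beta+\gamma}},$$ where, for $n\equiv m \bmod 2$, $$\overline P(n,m) = \sum_{k\ge0} \left( \binom{n}{\frac{n-k}2} - \binom{n}{\frac{n-k}2-1}\right) (-1)^{(k-m)/2} q^{\binom{(k-m)/2+1}2} \begin{bmatrix} \frac{k+m}2\\ \frac{k-m}2\end{bmatrix}_q,$$ and $\overline P(n,m)=0$ if $n\not\equiv m\bmod 2$.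
   Context: Let $a,b,c,d,q$ be indeterminates (generic parameters). The monic Askey-Wilson polynomials $P_n(x)=P_n(x;a,b,c,d;q)$ are defined by $P_{-1}=0$, $P_0=1$, $P_{n+1}=(x-b_n)P_n-\lambda_nP_{n-1}$, with $b_n=\frac12(a+a^{-1}-(A_n+C_n))$, $\lambda_n=\frac14A_{n-1}C_n$, where $$A_n=\frac{(1-abq^n)(1-acq^n)(1-adq^n)(1-abcdq^{n-1})}{a(1-abcdq^{2n-1})(1-abcdq^{2n})},\quad C_n=\frac{a(1-q^n)(1-bcq^{n-1})(1-bdq^{n-1})(1-cdq^{n-1})}{(1-abcdq^{2n-2})(1-abcdq^{2n-1})}$$ (for $n=0$ the common factor $1-abcdq^{-1}$ in $A_0$ is cancelled, and $C_0=0$). The moment $\mu_n(a,b,c,d;q)=L(x^n)$, where $L$ is the unique linear functional on polynomials in $x$ with $L(1)=1$ and $L(P_n)=0$ for all $n\ge1$ (so that $L(P_mP_n)=0$ for $m\neq n$). It is a rational function of $a,b,c,d,q$, symmetric in $a,b,c,d$. Notation: $(x)_m=(x;q)_m=\prod_{i=0}^{m-1}(1-xq^i)$; $\begin{bmatrix} n\\k\end{bmatrix}_q=\frac{(q)_n}{(q)_k(q)_{n-k}}$ if $0\le k\le n$ and $0$ otherwise; $\begin{bmatrix} \alpha+\beta+\gamma+\delta\\ \alpha,\beta,\gamma,\delta\end{bmatrix}_q=\frac{(q)_{\alpha+\beta+\gamma+\delta}}{(q)_\alpha(q)_\beta(q)_\gamma(q)_\delta}$. $\binom nr=0$ unless $r$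 is an integer with $0\le r\le n$. In particular, in the formula for $\overline P(n,m)$ only $m\le k\le n$ with $k\equiv n\bmod 2$ contribute, $\overline P(n,m)=0$ for $m>n$, and the sum in the claim is finite. *)

theory Defs
  imports Complex_Main "HOL-Computational_Algebra.Computational_Algebra"
begin

definition qpoch :: "'a::field \<Rightarrow> 'a \<Rightarrow> nat \<Rightarrow> 'a" where
  "qpoch q x m = (\<Prod>i<m. 1 - x * q ^ i)"

definition qbinom :: "'a::field \<Rightarrow> nat \<Rightarrow> nat \<Rightarrow> 'a" where
  "qbinom q n k = (if k \<le> n then qpoch q q n / (qpoch q q k * qpoch q q (n - k)) else 0)"

definition qmultinom4 :: "'a::field \<Rightarrow> nat \<Rightarrow> nat \<Rightarrow> nat \<Rightarrow> nat \<Rightarrow> 'a" where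
  "qmultinom4 q \<alpha> \<beta> \<gamma> \<delta> =
     qpoch q q (\<alpha> + \<beta> + \<gamma> + \<delta>) / (qpoch q q \<alpha> * qpoch q q \<beta> * qpoch q q \<gamma> * qpoch q q \<delta>)"

(* For n = 0 the factor 1 - abcd/q, which occurs in both the numerator and the denominator of the
   general formula, is cancelled.  In the other branch n \<ge> 1, so the subtractions do not truncate. *)
definition aw_A :: "'a::field \<Rightarrow> 'a \<Rightarrow> 'a \<Rightarrow> 'a \<Rightarrow> 'a \<Rightarrow> nat \<Rightarrow> 'a" where
  "aw_A a b c d q n =
     (if n = 0 then (1 - a*b) * (1 - a*c) * (1 - a*d) / (a * (1 - a*b*c*d))
      else (1 - a*b*q^n) * (1 - a*c*q^n) * (1 - a*d*q^n) * (1 - a*b*c*d*q^(n-1)) /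
           (a * (1 - a*b*c*d*q^(2*n-1)) * (1 - a*b*c*d*q^(2*n))))"

definition aw_C :: "'a::field \<Rightarrow> 'a \<Rightarrow> 'a \<Rightarrow> 'a \<Rightarrow> 'a \<Rightarrow> nat \<Rightarrow> 'a" where
  "aw_C a b c d q n =
     (if n = 0 then 0
      else a * (1 - q^n) * (1 - b*c*q^(n-1)) * (1 - b*d*q^(n-1)) * (1 - c*d*q^(n-1)) /
           ((1 - a*b*c*d*q^(2*n-2)) * (1 - a*b*c*d*q^(2*n-1))))"

definition aw_b :: "'a::field \<Rightarrow> 'a \<Rightarrow> 'a \<Rightarrow> 'a \<Rightarrow> 'a \<Rightarrow> nat \<Rightarrow> 'a" where
  "aw_b a b c d q n = (a + inverse a - (aw_A a b c d q n + aw_C a b c d q n)) / 2"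

(* Only used for n \<ge> 1. *)
definition aw_lambda :: "'a::field \<Rightarrow> 'a \<Rightarrow> 'a \<Rightarrow> 'a \<Rightarrow> 'a \<Rightarrow> nat \<Rightarrow> 'a" where
  "aw_lambda a b c d q n = aw_A a b c d q (n - 1) * aw_C a b c d q n / 4"

(* The second equation is the recurrence at n = 0 with P_{-1} = 0; [:- t, 1:] is x - t. *)
fun aw_poly :: "'a::field \<Rightarrow> 'a \<Rightarrow> 'a \<Rightarrow> 'a \<Rightarrow> 'a \<Rightarrow> nat \<Rightarrow> 'a poly" where
  "aw_poly a b c d q 0 = 1"
| "aw_poly a b c d q (Suc 0) = [:- aw_b a b c d q 0, 1:]"
| "aw_poly a b c d q (Suc (Suc n)) =
     [:- aw_b a b c d q (Suc n), 1:] * aw_poly a b c d q (Suc n)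
     - smult (aw_lambda a b c d q (Suc n)) (aw_poly a b c d q n)"

definition is_aw_functional ::
    "'a::field \<Rightarrow> 'a \<Rightarrow> 'a \<Rightarrow> 'a \<Rightarrow> 'a \<Rightarrow> ('a poly \<Rightarrow> 'a) \<Rightarrow> bool" where
  "is_aw_functional a b c d q L \<longleftrightarrow>
     Vector_Spaces.linear smult (*) L \<and> L 1 = 1 \<and> (\<forall>n\<ge>1. L (aw_poly a b c d q n) = 0)"

(* Well defined by ex1_aw_functional below. *)
definition aw_functional :: "'a::field \<Rightarrow> 'a \<Rightarrow> 'a \<Rightarrow> 'a \<Rightarrow> 'a \<Rightarrow> 'a poly \<Rightarrow> 'a" where
  "aw_functional a b c d q = (THE L. is_aw_functional a b c d q L)"

definition aw_moment :: "'a::field \<Rightarrow> 'a \<Rightarrow> 'a \<Rightarrow> 'a \<Rightarrow> 'a \<Rightarrow> nat \<Rightarrow> 'a" where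
  "aw_moment a b c d q n = aw_functional a b c d q (monom 1 n)"

(* The sum runs over all k that can contribute: the q-binomial coefficient vanishes for k < m and
   the difference of binomials vanishes for k > n or k of the other parity.  For k = n the second
   binomial coefficient has lower index -1 and is 0.  In particular Pbar q n m = 0 for m > n, so a sum over all
   \<alpha>, \<beta>, \<gamma>, \<delta> of terms with the factor Pbar q n (\<alpha> + \<beta> + \<gamma> + \<delta>) may be restricted to
   \<alpha>, \<beta>, \<gamma>, \<delta> \<le> n. *)
definition Pbar :: "'a::field \<Rightarrow> nat \<Rightarrow> nat \<Rightarrow> 'a" where
  "Pbar q n m =
     (if even (n + m) then
        (\<Sum>k | m \<le> k \<and> k \<le> n \<and> even (n + k).
           (of_nat (n choose ((n - k) div 2))
            - (if k = n then 0 else of_nat (n choose ((n - k) div 2 - 1))))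
           * (- 1) ^ ((k - m) div 2) * q ^ (((k - m) div 2 + 1) choose 2)
           * qbinom q ((k + m) div 2) ((k - m) div 2))
      else 0)"

lemma aw_poly_monic: "degree (aw_poly a b c d q n) = n \<and> coeff (aw_poly a b c d q n) n = 1"
proof (induction n rule: less_induct)
  case (less n)
  consider "n = 0" | "n = Suc 0" | k where "n = Suc (Suc k)"
    by (metis not0_implies_Suc)
  then show ?case
  proof cases
    case 3
    define P where "P = aw_poly a b c d q (Suc k)"
    define Q where "Q = aw_poly a b c d q k"
    define u where "u = - aw_b a b c d q (Suc k)"
    define l where "l = aw_lambda a b c d q (Suc k)"
    have P: "degree P = Suc k" "coeff P (Suc k) = 1" and Q: "degree Q = k"
      using less 3 by (auto simp: P_def Q_def)
    have eq: "aw_poly a b c d q n = [:u, 1:] * P - smult l Q"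
      by (simp add: 3 P_def Q_def u_def l_def)
    have "degree ([:u, 1:] * P - smult l Q) \<le> n"
    proof (rule degree_diff_le)
      show "degree ([:u, 1:] * P) \<le> n"
        using degree_mult_le[of "[:u, 1:]" P] P 3 by simp
      show "degree (smult l Q) \<le> n"
        using degree_smult_le[of l Q] Q 3 by simp
    qed
    moreover have c: "coeff ([:u, 1:] * P - smult l Q) n = 1"
      using P Q 3 by (simp add: coeff_eq_0)
    ultimately show ?thesis
      unfolding eq using le_degree[of "[:u, 1:] * P - smult l Q" n] by auto
  qed auto
qed

fun aw_rec_moment :: "'a::field \<Rightarrow> 'a \<Rightarrow> 'a \<Rightarrow> 'a \<Rightarrow> 'a \<Rightarrow> nat \<Rightarrow> 'a" where
  "aw_rec_moment a b c d q n =
     (if n = 0 then 1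
      else - (\<Sum>i<n. coeff (aw_poly a b c d q n) i * aw_rec_moment a b c d q i))"

declare aw_rec_moment.simps [simp del]

lemma vector_space_poly: "vector_space (smult :: 'a::field \<Rightarrow> 'a poly \<Rightarrow> 'a poly)"
  by unfold_locales (auto simp: smult_add_right smult_add_left)

lemma vector_space_field: "vector_space ((*) :: 'a::field \<Rightarrow> 'a \<Rightarrow> 'a)"
  by unfold_locales (auto simp: algebra_simps)

lemma linear_poly_iff:
  "Vector_Spaces.linear smult (*) (L :: 'a::field poly \<Rightarrow> 'a) \<longleftrightarrow>
     (\<forall>p r. L (p + r) = L p + L r) \<and> (\<forall>k p. L (smult k p) = k * L p)"
  unfolding Vector_Spaces.linear_def module_hom_def module_hom_axioms_def
  using vector_space_poly vector_space_field
  by (auto simp: module_iff_vector_space)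

lemma linear_poly_sum:
  assumes "Vector_Spaces.linear smult (*) (L :: 'a::field poly \<Rightarrow> 'a)" "degree p \<le> N"
  shows "L p = (\<Sum>i\<le>N. coeff p i * L (monom 1 i))"
proof -
  interpret Vector_Spaces.linear smult "(*)" L by fact
  have "p = (\<Sum>i\<le>N. smult (coeff p i) (monom 1 i))"
    using poly_as_sum_of_monoms'[OF assms(2)] by (simp add: smult_monom)
  then have "L p = L (\<Sum>i\<le>N. smult (coeff p i) (monom 1 i))"
    by simp
  then show ?thesis by (simp add: sum scale)
qed

lemma ex1_aw_functional: "\<exists>!L. is_aw_functional a b c d q L"
proof (rule ex_ex1I)
  define \<mu> where "\<mu> = aw_rec_moment a b c d q"
  define L where "L p = (\<Sum>i\<le>degree p. coeff p i * \<mu> i)" for p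
  have L: "L p = (\<Sum>i\<le>N. coeff p i * \<mu> i)" if "degree p \<le> N" for p N
    unfolding L_def by (rule sum.mono_neutral_left) (use that in \<open>auto simp: coeff_eq_0\<close>)
  have add: "L (p + r) = L p + L r" for p r
  proof -
    define N where "N = max (degree p) (degree r)"
    have "degree (p + r) \<le> N" "degree p \<le> N" "degree r \<le> N"
      by (auto simp: N_def degree_add_le_max)
    then show ?thesis by (simp add: L sum.distrib algebra_simps)
  qed
  have scale: "L (smult k p) = k * L p" for k p
    using L[of "smult k p" "degree p"] L[of p "degree p"] degree_smult_le[of k p]
    by (simp add: sum_distrib_left mult.assoc)
  have "L (aw_poly a b c d q n) = 0" if "n \<ge> 1" for n
  proof -
    have "L (aw_poly a b c d q n) = (\<Sum>i<n. coeff (aw_poly a b c d q n) i * \<mu> i) + \<mu> n"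
      using L[of "aw_poly a b c d q n" n] aw_poly_monic[of a b c d q n]
      by (simp flip: lessThan_Suc_atMost)
    also have "\<mu> n = - (\<Sum>i<n. coeff (aw_poly a b c d q n) i * \<mu> i)"
      using that unfolding \<mu>_def by (subst aw_rec_moment.simps) simp
    finally show ?thesis by simp
  qed
  moreover have "L 1 = 1"
    by (simp add: L_def \<mu>_def aw_rec_moment.simps)
  ultimately have "is_aw_functional a b c d q L"
    unfolding is_aw_functional_def linear_poly_iff using add scale by blast
  then show "\<exists>L. is_aw_functional a b c d q L" by blast
next
  fix L M
  assume L: "is_aw_functional a b c d q L" and M: "is_aw_functional a b c d q M"
  have lin: "Vector_Spaces.linear smult (*) L" "Vector_Spaces.linear smult (*) M"
    using L M by (auto simp: is_aw_functional_def)
  have step: "K (monom 1 n) = - (\<Sum>i<n. coeff (aw_poly a b c d q n) i * K (monom 1 i))"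
    if "is_aw_functional a b c d q K" "n \<ge> 1" for K n
  proof -
    have "0 = K (aw_poly a b c d q n)"
      using that by (simp add: is_aw_functional_def)
    also have "\<dots> = (\<Sum>i\<le>n. coeff (aw_poly a b c d q n) i * K (monom 1 i))"
      using that aw_poly_monic[of a b c d q n]
      by (intro linear_poly_sum) (auto simp: is_aw_functional_def)
    also have "\<dots> = (\<Sum>i<n. coeff (aw_poly a b c d q n) i * K (monom 1 i)) + K (monom 1 n)"
      using aw_poly_monic[of a b c d q n] by (simp flip: lessThan_Suc_atMost)
    finally show ?thesis by (simp add: eq_neg_iff_add_eq_0 add.commute)
  qed
  have eq: "L (monom 1 n) = M (monom 1 n)" for n
  proof (induction n rule: less_induct)
    case (less n)
    show ?case
    proof (cases "n = 0")
      case True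
      then show ?thesis using L M by (simp add: is_aw_functional_def)
    next
      case False
      then show ?thesis using step[OF L, of n] step[OF M, of n] less by simp
    qed
  qed
  show "L = M"
  proof
    fix p
    show "L p = M p"
      using linear_poly_sum[OF lin(1), of p "degree p"] linear_poly_sum[OF lin(2), of p "degree p"]
      by (simp add: eq)
  qed
qed

end

theory Submission
  imports Defs
begin

text \<open>
  Let \<open>H\<^sub>m\<close> be the continuous \<open>q\<close>-Hermite polynomials. Expanding \<open>(2x)\<^sup>n\<close> first in Chebyshev
  polynomials and then in the \<open>H\<^sub>m\<close> gives the coefficients \<open>Pbar q n m\<close>, so the theorem amounts to the
  formula \<open>L (H\<^sub>m) = h\<^sub>m\<close>, where \<open>h\<^sub>m\<close> is the sum over \<open>\<alpha> + \<beta> + \<gamma> + \<delta> = m\<close>. The generating function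
  of \<open>h\<^sub>m / (q)\<^sub>m\<close> satisfies a \<open>q\<close>-difference equation which says that multiplying by
  \<open>1 - 2ax + a\<^sup>2\<close> replaces \<open>a\<close> by \<open>aq\<close>, up to the factor \<open>(1 - ab)(1 - ac)(1 - ad) / (1 - abcd)\<close>. Hence
  the functional \<open>\<Lambda>\<close> with \<open>\<Lambda>(H\<^sub>m) = h\<^sub>m\<close> takes product values on
  \<open>\<phi>\<^sub>k = (ae\<^sup>i\<^sup>\<theta>)\<^sub>k (ae\<^sup>-\<^sup>i\<^sup>\<theta>)\<^sub>k\<close>. The \<open>q\<close>-Saalschuetz sum then suggests a product formula for
  \<open>\<Lambda>(P\<^sub>n \<phi>\<^sub>k)\<close>, with the factor \<open>\<Prod>i<n. q\<^sup>i - q\<^sup>k\<close>; it follows from the three-term recurrence by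
  induction on \<open>n\<close>. At \<open>k = 0\<close> it yields \<open>\<Lambda>(P\<^sub>n) = 0\<close> for \<open>n \<ge> 1\<close>, so \<open>\<Lambda> = L\<close>.
\<close>

subsection \<open>\<open>q\<close>-exponential and \<open>q\<close>-binomial series\<close>

lemma qpoch_0 [simp]: "qpoch q x 0 = 1"
  by (simp add: qpoch_def)

lemma qpoch_Suc: "qpoch q x (Suc n) = qpoch q x n * (1 - x * q ^ n)"
  by (simp add: qpoch_def)

lemma qpoch_Suc_left: "qpoch q x (Suc n) = (1 - x) * qpoch q (x * q) n"
  unfolding qpoch_def by (subst prod.lessThan_Suc_shift) (simp add: mult.assoc)

lemma qpoch_self_nonzero:
  assumes "\<And>j::nat. j \<ge> 1 \<Longrightarrow> q ^ j \<noteq> (1::'a::field)"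
  shows "qpoch q q n \<noteq> 0"
  using assms[of "Suc _"] by (simp add: qpoch_def)

lemma qpoch_nonzero:
  assumes "\<And>j::nat. x * q ^ j \<noteq> (1::'a::field)"
  shows "qpoch q x n \<noteq> 0"
  using assms by (simp add: qpoch_def)

text \<open>The substitution of \<open>c t\<close> for \<open>t\<close>. It is multiplicative, so
  \<open>q\<close>-difference equations of factors combine.\<close>

definition fps_dil :: "'a::field \<Rightarrow> 'a fps \<Rightarrow> 'a fps" where
  "fps_dil c F = Abs_fps (\<lambda>n. c ^ n * F $ n)"

lemma fps_dil_nth [simp]: "fps_dil c F $ n = c ^ n * F $ n"
  by (simp add: fps_dil_def)

lemma fps_dil_mult: "fps_dil c (F * G) = fps_dil c F * fps_dil c G"
proof (rule fps_ext)
  fix n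
  have "(\<Sum>i=0..n. c ^ n * (F $ i * G $ (n - i)))
      = (\<Sum>i=0..n. c ^ i * F $ i * (c ^ (n - i) * G $ (n - i)))"
  proof (intro sum.cong refl)
    fix i assume "i \<in> {0..n}"
    then have "c ^ n = c ^ i * c ^ (n - i)" by (simp flip: power_add)
    then show "c ^ n * (F $ i * G $ (n - i)) = c ^ i * F $ i * (c ^ (n - i) * G $ (n - i))"
      by (simp add: mult_ac)
  qed
  then show "fps_dil c (F * G) $ n = (fps_dil c F * fps_dil c G) $ n"
    by (simp add: fps_mult_nth sum_distrib_left)
qed

lemma fps_dil_dil: "fps_dil c (fps_dil d F) = fps_dil (c * d) F"
  by (rule fps_ext) (simp add: power_mult_distrib)

lemma fps_dil_linear: "fps_dil c (1 - fps_const x * fps_X) = 1 - fps_const (x * c) * fps_X"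
  by (rule fps_ext) (simp add: fps_X_def fps_one_def)

text \<open>In the notation of infinite products, \<open>qexp q\<close> is \<open>1 / (t)\<^sub>\<infinity>\<close> and \<open>qbin_fps q x\<close> is
  \<open>(xt)\<^sub>\<infinity> / (t)\<^sub>\<infinity>\<close>; the \<open>q\<close>-difference equations below stand in for these products.\<close>

definition qexp :: "'a::field \<Rightarrow> 'a fps" where
  "qexp q = Abs_fps (\<lambda>n. 1 / qpoch q q n)"

definition qbin_fps :: "'a::field \<Rightarrow> 'a \<Rightarrow> 'a fps" where
  "qbin_fps q x = Abs_fps (\<lambda>n. qpoch q x n / qpoch q q n)"

lemma one_minus_mult_nth:
  "((1 - fps_const (x::'a::field) * fps_X) * F) $ n = F $ n - (if n = 0 then 0 else x * F $ (n - 1))"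
proof -
  have "(1 - fps_const x * fps_X) * F = F - fps_const x * (fps_X * F)"
    by (simp add: left_diff_distrib mult.assoc)
  then show ?thesis by simp
qed

lemma one_minus_X_mult_nth:
  "((1 - fps_X) * F) $ n = F $ n - (if n = 0 then 0 else (F $ (n - 1) :: 'a::field))"
  using one_minus_mult_nth[of 1 F n] by simp

context
  fixes q :: "'a::field"
  assumes q: "\<And>j::nat. j \<ge> 1 \<Longrightarrow> q ^ j \<noteq> 1"
begin

lemma qpoch_qq: "qpoch q q n \<noteq> 0"
  using q by (rule qpoch_self_nonzero)

lemma one_minus_q_power: "1 - q * q ^ n \<noteq> 0"
  using q[of "Suc n"] by simp

text \<open>Replacing \<open>t\<close> by \<open>q t\<close> removes the first factor
  \<open>1 - t\<close> of \<open>(t)_inf\<close>.\<close>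

lemma qexp_dil: "fps_dil q (qexp q) = (1 - fps_X) * qexp q"
proof (rule fps_ext)
  fix n
  show "fps_dil q (qexp q) $ n = ((1 - fps_X) * qexp q) $ n"
  proof (cases n)
    case (Suc m)
    have "q ^ Suc m / (P * r) = 1 / (P * r) - 1 / P" if "r = 1 - q ^ Suc m" "P \<noteq> 0" "r \<noteq> 0" for P r
      using that by (simp add: field_simps)
    from this[OF _ qpoch_qq one_minus_q_power] show ?thesis
      unfolding one_minus_X_mult_nth by (simp add: Suc qexp_def qpoch_Suc)
  qed (simp add: qexp_def)
qed

text \<open>The same substitution removes \<open>1 - x t\<close> from the numerator and
  \<open>1 - t\<close> from the denominator.\<close>

lemma qbin_fps_dil:
  "(1 - fps_const x * fps_X) * fps_dil q (qbin_fps q x) = (1 - fps_X) * qbin_fps q x"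
proof (rule fps_ext)
  fix n
  show "((1 - fps_const x * fps_X) * fps_dil q (qbin_fps q x)) $ n = ((1 - fps_X) * qbin_fps q x) $ n"
  proof (cases n)
    case (Suc m)
    have "q * y * (A * (1 - x * y) / (P * r)) - x * (y * (A / P)) = A * (1 - x * y) / (P * r) - A / P"
      if "r = 1 - q * y" "P \<noteq> 0" "r \<noteq> 0" for A P r y
      using that by (simp add: divide_simps) (simp add: algebra_simps)
    from this[OF _ qpoch_qq one_minus_q_power] show ?thesis
      unfolding one_minus_mult_nth one_minus_X_mult_nth
      by (simp add: Suc qbin_fps_def qpoch_Suc)
  qed (simp add: qbin_fps_def one_minus_mult_nth one_minus_X_mult_nth)
qed

lemma qbin_fps_shift: "(1 - fps_const x * fps_X) * qbin_fps q (x * q) = qbin_fps q x"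
proof (rule fps_ext)
  fix n
  show "((1 - fps_const x * fps_X) * qbin_fps q (x * q)) $ n = qbin_fps q x $ n"
  proof (cases n)
    case (Suc m)
    have "A * (1 - x * q * y) / (P * r) - x * (A / P) = (1 - x) * A / (P * r)"
      if "r = 1 - q * y" "P \<noteq> 0" "r \<noteq> 0" for A P r y
      using that by (simp add: divide_simps) (simp add: algebra_simps)
    from this[OF _ qpoch_qq one_minus_q_power] show ?thesis
      unfolding one_minus_mult_nth
      by (simp add: Suc qbin_fps_def qpoch_Suc_left[of q x] qpoch_Suc[of q "x * q"] qpoch_Suc[of q q])
  qed (simp add: qbin_fps_def one_minus_mult_nth)
qed

end

subsection \<open>Contiguous relations in the parameter \<open>a\<close>\<close>

text \<open>As infinite products, \<open>(abct)(bcdt) / ((bt)(ct))\<close>.\<close>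

definition bc_series :: "'a::field \<Rightarrow> 'a \<Rightarrow> 'a \<Rightarrow> 'a \<Rightarrow> 'a \<Rightarrow> 'a fps" where
  "bc_series q a b c d = fps_dil b (qbin_fps q (a * c)) * fps_dil c (qbin_fps q (b * d))"

text \<open>The factor depends on \<open>beta + gamma\<close> alone and acts coefficientwise, so the
  product form of \<open>bc_series\<close> is lost; relations are carried over through
  coefficients.\<close>

definition abcd_series :: "'a::field \<Rightarrow> 'a \<Rightarrow> 'a \<Rightarrow> 'a \<Rightarrow> 'a \<Rightarrow> 'a fps" where
  "abcd_series q a b c d = Abs_fps (\<lambda>n. qpoch q (a * d) n / qpoch q (a * b * c * d) n * bc_series q a b c d $ n)"

text \<open>The generating function of \<open>h_m / (q)_m\<close>; the two exponentials supply the
  sums over \<open>alpha\<close> and \<open>delta\<close>.\<close>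

definition hermite_series :: "'a::field \<Rightarrow> 'a \<Rightarrow> 'a \<Rightarrow> 'a \<Rightarrow> 'a \<Rightarrow> 'a fps" where
  "hermite_series q a b c d = fps_dil a (qexp q) * (fps_dil d (qexp q) * abcd_series q a b c d)"

definition hermite_moment :: "'a::field \<Rightarrow> 'a \<Rightarrow> 'a \<Rightarrow> 'a \<Rightarrow> 'a \<Rightarrow> nat \<Rightarrow> 'a" where
  "hermite_moment q a b c d m = qpoch q q m * hermite_series q a b c d $ m"

text \<open>Multiplication by \<open>x\<close> on the \<open>q\<close>-Hermite polynomials, \<open>2x H\<^sub>m = H\<^sub>m\<^sub>+\<^sub>1 + (1 - q\<^sup>m) H\<^sub>m\<^sub>-\<^sub>1\<close>; at
  \<open>m = 0\<close> the truncated index is harmless because its coefficient vanishes.\<close>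

definition hermite_step :: "'a::field \<Rightarrow> (nat \<Rightarrow> 'a) \<Rightarrow> nat \<Rightarrow> 'a" where
  "hermite_step q g m = (g (Suc m) + (1 - q ^ m) * g (m - 1)) / 2"

lemma one_minus_fps_X_nonzero: "1 - fps_const (x::'a::field) * fps_X \<noteq> 0"
proof
  assume "1 - fps_const x * fps_X = 0"
  then have "(1 - fps_const x * fps_X) $ 0 = (0 :: 'a fps) $ 0" by simp
  then show False by simp
qed

context
  fixes q :: "'a::field"
  assumes q: "\<And>j::nat. j \<ge> 1 \<Longrightarrow> q ^ j \<noteq> 1"
begin

lemma qexp_dil_dil: "fps_dil q (fps_dil x (qexp q)) = (1 - fps_const x * fps_X) * fps_dil x (qexp q)"
  using arg_cong[OF qexp_dil[OF q], of "fps_dil x"] fps_dil_linear[of x 1]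
  by (simp add: fps_dil_mult fps_dil_dil mult.commute)

lemma qbin_fps_dil_dil:
  "(1 - fps_const (x * y) * fps_X) * fps_dil q (fps_dil y (qbin_fps q x))
    = (1 - fps_const y * fps_X) * fps_dil y (qbin_fps q x)"
  using arg_cong[OF qbin_fps_dil[OF q], of "fps_dil y" x] fps_dil_linear[of y 1] fps_dil_linear[of y x]
  by (simp add: fps_dil_mult fps_dil_dil mult.commute)

text \<open>Only the factor \<open>(abct)\<close> depends on \<open>a\<close>, and the shift to
  \<open>a q\<close> removes its first factor.\<close>

lemma bc_series_shift:
  "(1 - fps_const (a * b * c) * fps_X) * bc_series q (a * q) b c d = bc_series q a b c d"
proof -
  have "(1 - fps_const (a * c * b) * fps_X) * fps_dil b (qbin_fps q (a * c * q)) = fps_dil b (qbin_fps q (a * c))"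
    using arg_cong[OF qbin_fps_shift[OF q], of "fps_dil b" "a * c"]
    by (simp add: fps_dil_mult fps_dil_linear)
  moreover have "a * q * c = a * c * q" "a * b * c = a * c * b"
    by (simp_all add: mult_ac)
  ultimately show ?thesis
    unfolding bc_series_def by (simp only: mult.assoc[symmetric])
qed

lemma bc_series_dil:
  "(1 - fps_const (a * b * c) * fps_X) * (1 - fps_const (b * c * d) * fps_X) * fps_dil q (bc_series q a b c d)
    = (1 - fps_const b * fps_X) * (1 - fps_const c * fps_X) * bc_series q a b c d"
proof -
  have "((1 - fps_const (a * c * b) * fps_X) * fps_dil q (fps_dil b (qbin_fps q (a * c)))) *
    ((1 - fps_const (b * d * c) * fps_X) * fps_dil q (fps_dil c (qbin_fps q (b * d)))) =
    (1 - fps_const b * fps_X) * (1 - fps_const c * fps_X) * bc_series q a b c d"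
    unfolding qbin_fps_dil_dil by (simp add: bc_series_def mult_ac)
  then show ?thesis by (simp add: bc_series_def fps_dil_mult mult_ac)
qed

text \<open>After multiplication by \<open>1 - bcd t\<close>, the series and its dilation are both
  polynomial multiples of the series at \<open>a q\<close>; what remains is a polynomial
  identity.\<close>

lemma bc_series_contiguous:
  "fps_const ((1 - a * b) * (1 - a * c)) * fps_X * bc_series q (a * q) b c d =
    fps_X * bc_series q a b c d - fps_const a * (bc_series q a b c d - fps_dil q (bc_series q a b c d))
    - fps_const (a * b * c * d) * fps_X * fps_dil q (bc_series q a b c d)"
proof -
  define U where "U = bc_series q a b c d"
  define V where "V = bc_series q (a * q) b c d"
  define D where "D = fps_dil q U"
  define K where "K = 1 - fps_const (b * c * d) * fps_X"
  define M where "M = 1 - fps_const (a * b * c) * fps_X"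
  have U: "U = M * V"
    by (simp add: U_def V_def M_def bc_series_shift)
  have M: "M \<noteq> 0" and K: "K \<noteq> 0"
    by (auto simp: M_def K_def one_minus_fps_X_nonzero)
  have "M * (K * D) = M * ((1 - fps_const b * fps_X) * (1 - fps_const c * fps_X) * V)"
    using bc_series_dil[of a b c d] unfolding D_def M_def K_def U_def V_def
    by (simp add: mult_ac flip: bc_series_shift[of a b c d])
  then have KD: "K * D = (1 - fps_const b * fps_X) * (1 - fps_const c * fps_X) * V"
    using M by simp
  define A where "A = fps_const a"
  define B where "B = fps_const b"
  define C where "C = fps_const c"
  define E where "E = fps_const d"
  have "K * ((1 - A * B) * (1 - A * C) * fps_X * V)
      = K * (fps_X * (M * V) - A * (M * V)) + (A - A * B * C * E * fps_X) * (K * D)"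
    unfolding KD unfolding K_def M_def A_def[symmetric] B_def[symmetric] C_def[symmetric] E_def[symmetric]
      fps_const_mult[symmetric]
    by algebra
  also have "\<dots> = K * (fps_X * U - A * (U - D) - A * B * C * E * fps_X * D)"
    by (simp add: U algebra_simps)
  finally have "(1 - A * B) * (1 - A * C) * fps_X * V = fps_X * U - A * (U - D) - A * B * C * E * fps_X * D"
    using K by simp
  moreover have "fps_const ((1 - a * b) * (1 - a * c)) = (1 - A * B) * (1 - A * C)"
    by (simp add: A_def B_def C_def flip: fps_const_mult fps_const_sub)
  moreover have "fps_const (a * b * c * d) = A * B * C * E"
    by (simp add: A_def B_def C_def E_def)
  ultimately show ?thesis
    by (simp only: U_def V_def D_def A_def)
qed

lemma bc_series_contiguous_nth:
  "(1 - a * b) * (1 - a * c) * bc_series q (a * q) b c d $ n =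
    (1 - a * b * c * d * q ^ n) * bc_series q a b c d $ n - a * (1 - q ^ Suc n) * bc_series q a b c d $ Suc n"
  using arg_cong[OF bc_series_contiguous[of a b c d], of "\<lambda>F. F $ Suc n"]
  by (simp add: mult.assoc) (simp add: algebra_simps)

text \<open>Passing to \<open>a q\<close>, or from \<open>n\<close> to \<open>n + 1\<close>,
  multiplies \<open>(ad)_n / (abcd)_n\<close> by \<open>1 - ad q^n\<close> over
  \<open>1 - abcd q^n\<close>, up to a constant in the first case. The denominator cancels against
  the coefficient in \<open>bc_series_contiguous_nth\<close>.\<close>

lemma abcd_series_contiguous_nth:
  assumes "\<And>j::nat. a * b * c * d * q ^ j \<noteq> 1"
  shows "(1 - a * b) * (1 - a * c) * (1 - a * d) / (1 - a * b * c * d) * abcd_series q (a * q) b c d $ n =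
    (1 - a * d * q ^ n) * abcd_series q a b c d $ n - a * (1 - q ^ Suc n) * abcd_series q a b c d $ Suc n"
proof -
  define e where "e = a * b * c * d"
  have e: "1 - e * q ^ n \<noteq> 0" "1 - e \<noteq> 0" "qpoch q e n \<noteq> 0"
    using assms[of n] assms[of 0] qpoch_nonzero[OF assms] by (auto simp: e_def)
  define u where "u = bc_series q a b c d"
  have ad: "(1 - a * d) * qpoch q (a * d * q) n = qpoch q (a * d) n * (1 - a * d * q ^ n)"
    by (metis qpoch_Suc qpoch_Suc_left)
  have ee: "(1 - e) * qpoch q (e * q) n = qpoch q e n * (1 - e * q ^ n)"
    by (metis qpoch_Suc qpoch_Suc_left)
  have "(1 - a * b) * (1 - a * c) * (1 - a * d) / (1 - e) * abcd_series q (a * q) b c d $ n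
     = ((1 - a * b) * (1 - a * c) * bc_series q (a * q) b c d $ n) * ((1 - a * d) * qpoch q (a * d * q) n)
         / ((1 - e) * qpoch q (e * q) n)"
    by (simp add: abcd_series_def e_def mult_ac)
  also have "\<dots> = ((1 - e * q ^ n) * u $ n - a * (1 - q ^ Suc n) * u $ Suc n)
       * (qpoch q (a * d) n * (1 - a * d * q ^ n)) / (qpoch q e n * (1 - e * q ^ n))"
    by (simp only: ad ee bc_series_contiguous_nth) (simp add: u_def e_def)
  also have "\<dots> = (1 - a * d * q ^ n) * (qpoch q (a * d) n / qpoch q e n * u $ n)
     - a * (1 - q ^ Suc n) * (qpoch q (a * d) (Suc n) / qpoch q e (Suc n) * u $ Suc n)"
    using e by (simp add: divide_simps qpoch_Suc) (simp add: algebra_simps)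
  finally show ?thesis
    by (simp add: abcd_series_def u_def e_def)
qed

lemma abcd_series_contiguous:
  assumes "\<And>j::nat. a * b * c * d * q ^ j \<noteq> 1"
  shows "fps_const ((1 - a * b) * (1 - a * c) * (1 - a * d) / (1 - a * b * c * d)) * (fps_X * abcd_series q (a * q) b c d)
    = fps_const a * fps_dil q (abcd_series q a b c d) - fps_const (a * d) * (fps_X * fps_dil q (abcd_series q a b c d))
      - fps_const a * abcd_series q a b c d + fps_X * abcd_series q a b c d"
proof (rule fps_ext)
  fix n
  show "(fps_const ((1 - a * b) * (1 - a * c) * (1 - a * d) / (1 - a * b * c * d)) * (fps_X * abcd_series q (a * q) b c d)) $ n
    = (fps_const a * fps_dil q (abcd_series q a b c d) - fps_const (a * d) * (fps_X * fps_dil q (abcd_series q a b c d))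
      - fps_const a * abcd_series q a b c d + fps_X * abcd_series q a b c d) $ n"
  proof (cases n)
    case (Suc m)
    then show ?thesis
      using abcd_series_contiguous_nth[OF assms, of m] by (simp add: algebra_simps)
  qed simp
qed

text \<open>The shift to \<open>a q\<close> in the exponential yields a factor
  \<open>1 - a t\<close>. Together with \<open>1 - d t\<close> it turns the dilation of
  \<open>abcd_series\<close> into that of the whole product; the other terms come from
  \<open>(1 - a t)(t - a)\<close>.\<close>

lemma hermite_series_contiguous:
  assumes "\<And>j::nat. a * b * c * d * q ^ j \<noteq> 1"
  shows "fps_const ((1 - a * b) * (1 - a * c) * (1 - a * d) / (1 - a * b * c * d)) * (fps_X * hermite_series q (a * q) b c d)
    = fps_const a * fps_dil q (hermite_series q a b c d) - fps_const a * hermite_series q a b c d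
      + fps_const (1 + a\<^sup>2) * (fps_X * hermite_series q a b c d) - fps_const a * (fps_X * (fps_X * hermite_series q a b c d))"
proof -
  define A where "A = fps_dil a (qexp q)"
  define D where "D = fps_dil d (qexp q)"
  define S where "S = abcd_series q a b c d"
  define S' where "S' = abcd_series q (a * q) b c d"
  define k where "k = fps_const ((1 - a * b) * (1 - a * c) * (1 - a * d) / (1 - a * b * c * d))"
  have A': "fps_dil (a * q) (qexp q) = (1 - fps_const a * fps_X) * A"
    using qexp_dil_dil[of a] by (simp add: A_def fps_dil_dil mult.commute)
  have S': "k * (fps_X * S') = fps_const a * fps_dil q S - fps_const (a * d) * (fps_X * fps_dil q S) 
      - fps_const a * S + fps_X * S"
    unfolding k_def S_def S'_def by (rule abcd_series_contiguous[OF assms])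
  have "k * (fps_X * ((1 - fps_const a * fps_X) * A * (D * S')))
     = (1 - fps_const a * fps_X) * A * D * (k * (fps_X * S'))"
    by (simp add: mult_ac)
  also have "\<dots> = fps_const a * (((1 - fps_const a * fps_X) * A) * (((1 - fps_const d * fps_X) * D) * fps_dil q S))
     - fps_const a * (A * (D * S)) + (1 + fps_const a * fps_const a) * (fps_X * (A * (D * S)))
     - fps_const a * (fps_X * (fps_X * (A * (D * S))))"
    unfolding S' fps_const_mult[symmetric] by algebra
  also have "1 + fps_const a * fps_const a = fps_const (1 + a\<^sup>2)"
    by (simp add: power2_eq_square flip: fps_const_add)
  finally show ?thesis
    by (simp only: hermite_series_def fps_dil_mult A' qexp_dil_dil S_def S'_def k_def A_def[symmetric] D_def[symmetric])
      (simp only: A_def D_def qexp_dil_dil)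
qed

text \<open>The coefficient of \<open>t^(n+1)\<close> in the previous relation, times
  \<open>(q)_n\<close>; the left side is the value at \<open>(1 + a^2 - 2ax) H_n\<close>.\<close>

lemma hermite_moment_contiguous:
  assumes "\<And>j::nat. a * b * c * d * q ^ j \<noteq> 1" and 2: "(2::'a) \<noteq> 0"
  shows "(1 + a\<^sup>2) * hermite_moment q a b c d n - 2 * a * hermite_step q (hermite_moment q a b c d) n
    = (1 - a * b) * (1 - a * c) * (1 - a * d) / (1 - a * b * c * d) * hermite_moment q (a * q) b c d n"
proof -
  define G where "G = hermite_series q a b c d"
  define k where "k = (1 - a * b) * (1 - a * c) * (1 - a * d) / (1 - a * b * c * d)"
  have "(1 - a * b) * (1 - a * c) * (1 - a * d) / (1 - a * b * c * d) * hermite_series q (a * q) b c d $ n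
     = a * (q ^ Suc n * G $ Suc n) - a * G $ Suc n + (1 + a\<^sup>2) * G $ n - a * (if n = 0 then 0 else G $ (n - 1))"
    using arg_cong[OF hermite_series_contiguous[OF assms(1)], of "\<lambda>F. F $ Suc n"]
    unfolding G_def by simp
  also have "\<dots> = (1 + a\<^sup>2) * G $ n - a * (1 - q ^ Suc n) * G $ Suc n - a * (if n = 0 then 0 else G $ (n - 1))"
    by (simp add: algebra_simps)
  finally have "k * hermite_series q (a * q) b c d $ n
     = (1 + a\<^sup>2) * G $ n - a * (1 - q ^ Suc n) * G $ Suc n - a * (if n = 0 then 0 else G $ (n - 1))"
    by (simp only: k_def)
  then have k: "k * hermite_moment q (a * q) b c d n
     = qpoch q q n * ((1 + a\<^sup>2) * G $ n - a * (1 - q ^ Suc n) * G $ Suc n - a * (if n = 0 then 0 else G $ (n - 1)))"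
    by (simp only: hermite_moment_def mult.left_commute[of k])
  have h: "2 * a * hermite_step q (hermite_moment q a b c d) n
     = qpoch q q n * (a * (1 - q ^ Suc n) * G $ Suc n + a * (if n = 0 then 0 else G $ (n - 1)))"
  proof -
    have "2 * a * hermite_step q (hermite_moment q a b c d) n
      = a * (hermite_moment q a b c d (Suc n) + (1 - q ^ n) * hermite_moment q a b c d (n - 1))"
      using 2 by (simp add: hermite_step_def)
    then show ?thesis
      by (cases n) (simp_all add: hermite_moment_def qpoch_Suc G_def algebra_simps)
  qed
  have "(1 + a\<^sup>2) * hermite_moment q a b c d n - 2 * a * hermite_step q (hermite_moment q a b c d) n
    = k * hermite_moment q (a * q) b c d n"
    unfolding k h by (simp add: hermite_moment_def G_def algebra_simps)
  then show ?thesis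
    by (simp only: k_def)
qed

end

lemma hermite_moment_0 [simp]: "hermite_moment q a b c d 0 = 1"
  by (simp add: hermite_moment_def hermite_series_def abcd_series_def bc_series_def qexp_def qbin_fps_def)

subsection \<open>Powers of \<open>x\<close> in the basis of \<open>q\<close>-Hermite polynomials\<close>

text \<open>\<open>ballot n k\<close> is the coefficient of the Chebyshev polynomial \<open>U\<^sub>k\<close> in \<open>(2x)\<^sup>n\<close>, and
  \<open>cheb_hermite q k m\<close> that of \<open>H\<^sub>m\<close> in \<open>U\<^sub>k\<close>.\<close>

definition ballot :: "nat \<Rightarrow> nat \<Rightarrow> 'a::field" where
  "ballot n k = (if k \<le> n \<and> even (n + k) then
     of_nat (n choose ((n - k) div 2)) - (if k = n then 0 else of_nat (n choose ((n - k) div 2 - 1))) else 0)"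

definition cheb_hermite :: "'a::field \<Rightarrow> nat \<Rightarrow> nat \<Rightarrow> 'a" where
  "cheb_hermite q k m = (if m \<le> k \<and> even (k + m) then
     (- 1) ^ ((k - m) div 2) * q ^ (((k - m) div 2 + 1) choose 2) * qbinom q ((k + m) div 2) ((k - m) div 2)
   else 0)"

lemma Pbar_eq:
  fixes q :: "'a::field"
  shows "Pbar q n m = (\<Sum>k\<le>n. ballot n k * cheb_hermite q k m)"
proof (cases "even (n + m)")
  case True
  have "Pbar q n m = (\<Sum>k | m \<le> k \<and> k \<le> n \<and> even (n + k). ballot n k * cheb_hermite q k m)"
    unfolding Pbar_def using True
    by (auto simp: ballot_def cheb_hermite_def mult.assoc intro!: sum.cong)
  also have "\<dots> = (\<Sum>k\<le>n. ballot n k * cheb_hermite q k m)"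
    by (rule sum.mono_neutral_left) (auto simp: ballot_def cheb_hermite_def)
  finally show ?thesis .
next
  case False
  then have z: "(ballot n k :: 'a) * cheb_hermite q k m = 0" for k
    by (auto simp: ballot_def cheb_hermite_def)
  show ?thesis using False by (simp only: z sum.neutral_const) (simp add: Pbar_def)
qed

text \<open>Coefficient of \<open>U_k\<close> in \<open>2x (2x)^n\<close>, by
  \<open>2x U_k = U_(k+1) + U_(k-1)\<close>.\<close>

lemma ballot_Suc:
  "ballot (Suc n) k = (if k = 0 then 0 else ballot n (k - 1)) + (ballot n (Suc k) :: 'a::field)"
proof -
  consider "odd (Suc n + k)" | "k > Suc n" | i where "Suc n = k + 2 * i"
    by (metis dvdE even_add even_diff_nat le_add_diff_inverse not_le)
  then show ?thesis
  proof cases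
    case 1
    then show ?thesis by (cases k) (auto simp: ballot_def)
  next
    case 2
    then show ?thesis by (auto simp: ballot_def)
  next
    case 3
    show ?thesis
    proof (cases i)
      case 0
      then show ?thesis using 3 by (auto simp: ballot_def)
    next
      case (Suc j)
      have n: "n = k + 2 * j + 1" using 3 Suc by simp
      have b1: "ballot (Suc n) k = (of_nat (Suc n choose Suc j) - of_nat (Suc n choose j) :: 'a)"
        by (simp add: ballot_def n)
      have b2: "ballot n (Suc k) = (of_nat (n choose j) - (if j = 0 then 0 else of_nat (n choose (j - 1))) :: 'a)"
        by (auto simp: ballot_def n)
      show ?thesis
      proof (cases k)
        case 0
        \<comment> \<open>At \<open>k = 0\<close> the term from \<open>k - 1\<close> is absent; it
          would be the difference of the two middle binomials, which are equal as
          \<open>n = 2j + 1\<close>.\<close>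
        then have "n choose Suc j = n choose j"
          using binomial_symmetric[of j n] n by simp
        then show ?thesis unfolding b1 b2 using 0 by (cases j) auto
      next
        case (Suc k')
        have "ballot n k' = (of_nat (n choose Suc j) - of_nat (n choose j) :: 'a)"
          by (simp add: ballot_def n Suc)
        then show ?thesis unfolding b1 b2 using Suc by (cases j) auto
      qed
    qed
  qed
qed

context
  fixes q :: "'a::field"
  assumes q: "\<And>j::nat. j \<ge> 1 \<Longrightarrow> q ^ j \<noteq> 1"
begin

lemma cheb_hermite_diag: "cheb_hermite q k k = 1"
  using qpoch_qq[OF q] by (simp add: cheb_hermite_def qbinom_def binomial_eq_0)

lemma cheb_hermite_add:
  "cheb_hermite q (m + 2 * j) m = (- 1) ^ j * q ^ (Suc j choose 2) * (qpoch q q (m + j) / (qpoch q q j * qpoch q q m))"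
proof -
  have "(m + 2 * j + m) div 2 = m + j" by simp
  then show ?thesis by (simp add: cheb_hermite_def qbinom_def)
qed

text \<open>Both sides are the coefficient of \<open>H_m\<close> in \<open>2x U_k\<close>: the
  Chebyshev recurrence gives the left, the \<open>q\<close>-Hermite recurrence the right.\<close>

lemma cheb_hermite_Suc:
  "cheb_hermite q (Suc k) m + (if k = 0 then 0 else cheb_hermite q (k - 1) m)
    = (if m = 0 then 0 else cheb_hermite q k (m - 1)) + (1 - q ^ Suc m) * cheb_hermite q k (Suc m)"
proof -
  consider "odd (Suc k + m)" | "m > Suc k" | i where "Suc k = m + 2 * i"
    by (metis dvdE even_add even_diff_nat le_add_diff_inverse not_le)
  then show ?thesis
  proof cases
    case 1
    then show ?thesis by (cases m; cases k) (auto simp: cheb_hermite_def)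
  next
    case 2
    then show ?thesis by (cases k) (auto simp: cheb_hermite_def)
  next
    case 3
    show ?thesis
    proof (cases i)
      case 0
      then have "m = Suc k" using 3 by simp
      then show ?thesis by (cases k) (auto simp: cheb_hermite_diag, auto simp: cheb_hermite_def)
    next
      case (Suc j)
      have k: "k = m + 2 * j + 1" using 3 Suc by simp
      define y where "y = q ^ j"
      define Z where "Z = (- 1) ^ j * q ^ (Suc j choose 2)"
      define P where "P = qpoch q q (m + j)"
      have Z: "(- 1) ^ Suc j * q ^ (Suc (Suc j) choose 2) = - Z * (q * y)"
        by (simp add: Z_def y_def numeral_2_eq_2 power_add)
      have c1: "cheb_hermite q (Suc k) m = - Z * (q * y) * (P * (1 - q * (q ^ m * y)) / (qpoch q q j * (1 - q * y) * qpoch q q m))"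
        using cheb_hermite_add[of m "Suc j"] unfolding Z
        by (simp add: k P_def y_def qpoch_Suc power_add)
      have c2: "cheb_hermite q (k - 1) m = Z * (P / (qpoch q q j * qpoch q q m))"
        using cheb_hermite_add[of m j] by (simp add: k Z_def P_def)
      have c3: "cheb_hermite q k (Suc m) = Z * (P * (1 - q * (q ^ m * y)) / (qpoch q q j * (qpoch q q m * (1 - q * q ^ m))))"
        using cheb_hermite_add[of "Suc m" j] by (simp add: k Z_def P_def y_def qpoch_Suc power_add)
      have nz: "1 - q * y \<noteq> 0" "1 - q * q ^ m \<noteq> 0" "qpoch q q j \<noteq> 0" "qpoch q q m \<noteq> 0"
        unfolding y_def using qpoch_qq[OF q] one_minus_q_power[OF q] by auto
      show ?thesis
      proof (cases m)
        case 0
        show ?thesis unfolding c1 c2 c3 using nz 0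
          by (simp add: k divide_simps) (simp add: algebra_simps)
      next
        case (Suc l)
        have c4: "cheb_hermite q k l = - Z * (q * y) * (P / (qpoch q q j * (1 - q * y) * qpoch q q l))"
          using cheb_hermite_add[of l "Suc j"] unfolding Z by (simp add: k P_def y_def qpoch_Suc Suc)
        \<comment> \<open>To be used with \<open>M = q^m\<close>, \<open>J = (q)_j\<close> and
          \<open>L = (q)_(m-1)\<close>.\<close>
        have "- Z * (q * y) * (P * (1 - q * (M * y)) / (J * (1 - q * y) * (L * (1 - M)))) + Z * (P / (J * (L * (1 - M))))
          = - Z * (q * y) * (P / (J * (1 - q * y) * L))
            + (1 - q * M) * (Z * (P * (1 - q * (M * y)) / (J * (L * (1 - M) * (1 - q * M)))))"
          if "1 - q * y \<noteq> 0" "1 - q * M \<noteq> 0" "1 - M \<noteq> 0" "J \<noteq> 0" "L \<noteq> 0" for J L M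
          using that by (simp add: divide_simps) (simp add: algebra_simps)
        moreover have qm: "qpoch q q m = qpoch q q l * (1 - q ^ m)"
          by (simp add: Suc qpoch_Suc)
        moreover have "m \<noteq> 0" "k \<noteq> 0" "m - 1 = l"
          using Suc k by auto
        ultimately show ?thesis
          using nz by (simp only: c1 c2 c3 c4 if_False power_Suc mult_eq_0_iff not_False_eq_True de_Morgan_disj)
      qed
    qed
  qed
qed

lemma Pbar_0: "Pbar q 0 m = (if m = 0 then 1 else 0)"
  unfolding Pbar_eq using cheb_hermite_diag[of 0] by (auto simp: ballot_def cheb_hermite_def)

text \<open>Coefficient of \<open>H_m\<close> in \<open>2x (2x)^n\<close>: the shifts of
  \<open>k\<close> are moved from \<open>ballot\<close> to \<open>cheb_hermite\<close> and there
  exchanged for shifts of \<open>m\<close>.\<close>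

lemma Pbar_Suc: "Pbar q (Suc n) m = (if m = 0 then 0 else Pbar q n (m - 1)) + (1 - q ^ Suc m) * Pbar q n (Suc m)"
proof -
  let ?c = "\<lambda>k. cheb_hermite q k m"
  have "Pbar q (Suc n) m = (\<Sum>k\<le>Suc n. (if k = 0 then 0 else ballot n (k - 1)) * ?c k) + (\<Sum>k\<le>Suc n. ballot n (Suc k) * ?c k)"
    unfolding Pbar_eq ballot_Suc by (simp only: ring_distribs sum.distrib)
  also have "(\<Sum>k\<le>Suc n. (if k = 0 then 0 else ballot n (k - 1)) * ?c k) = (\<Sum>k\<le>n. ballot n k * ?c (Suc k))"
    by (subst sum.atMost_Suc_shift) simp
  \<comment> \<open>The end terms drop out because \<open>ballot n k\<close> vanishes for
    \<open>k > n\<close>.\<close>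
  also have "(\<Sum>k\<le>Suc n. ballot n (Suc k) * ?c k) = (\<Sum>k\<le>Suc n. ballot n k * (if k = 0 then 0 else ?c (k - 1)))"
    by (subst (2) sum.atMost_Suc_shift) (simp add: ballot_def)
  also have "\<dots> = (\<Sum>k\<le>n. ballot n k * (if k = 0 then 0 else ?c (k - 1)))"
    by (simp add: ballot_def)
  also have "(\<Sum>k\<le>n. ballot n k * ?c (Suc k)) + \<dots>
      = (\<Sum>k\<le>n. ballot n k * (?c (Suc k) + (if k = 0 then 0 else ?c (k - 1))))"
    by (simp only: ring_distribs sum.distrib)
  also have "\<dots> = (\<Sum>k\<le>n. (if m = 0 then 0 else ballot n k * cheb_hermite q k (m - 1))
       + (1 - q ^ Suc m) * (ballot n k * cheb_hermite q k (Suc m)))"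
    unfolding cheb_hermite_Suc by (intro sum.cong refl) (auto simp: algebra_simps)
  also have "\<dots> = (if m = 0 then 0 else Pbar q n (m - 1)) + (1 - q ^ Suc m) * Pbar q n (Suc m)"
    unfolding Pbar_eq sum.distrib sum_distrib_left by auto
  finally show ?thesis .
qed

lemma Pbar_eq_0: "m > n \<Longrightarrow> Pbar q n m = 0"
  unfolding Pbar_eq by (auto simp: cheb_hermite_def)

text \<open>The expansion of \<open>(2x)^n\<close> in the \<open>H_m\<close>, evaluated at
  \<open>g\<close>. The induction needs all \<open>g\<close>, since each factor \<open>x\<close> is
  moved onto \<open>g\<close>.\<close>

lemma Pbar_hstep:
  assumes 2: "(2::'a) \<noteq> 0"
  shows "2 ^ n * (hermite_step q ^^ n) g 0 = (\<Sum>m\<le>n. Pbar q n m * g m)"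
proof (induction n arbitrary: g)
  case 0
  then show ?case by (simp add: Pbar_0)
next
  case (Suc n)
  have "(\<Sum>m\<le>Suc n. Pbar q (Suc n) m * g m)
      = (\<Sum>m\<le>Suc n. (if m = 0 then 0 else Pbar q n (m - 1)) * g m)
        + (\<Sum>m\<le>Suc n. Pbar q n (Suc m) * ((1 - q ^ Suc m) * g m))"
    unfolding Pbar_Suc by (simp only: ring_distribs sum.distrib mult_ac)
  also have "(\<Sum>m\<le>Suc n. (if m = 0 then 0 else Pbar q n (m - 1)) * g m) = (\<Sum>m\<le>n. Pbar q n m * g (Suc m))"
    by (subst sum.atMost_Suc_shift) simp
  also have "(\<Sum>m\<le>Suc n. Pbar q n (Suc m) * ((1 - q ^ Suc m) * g m))
      = (\<Sum>m\<le>Suc n. Pbar q n m * ((1 - q ^ m) * g (m - 1)))"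
    by (subst (2) sum.atMost_Suc_shift) (simp add: Pbar_eq_0)
  also have "\<dots> = (\<Sum>m\<le>n. Pbar q n m * ((1 - q ^ m) * g (m - 1)))"
    by (simp add: Pbar_eq_0)
  also have "(\<Sum>m\<le>n. Pbar q n m * g (Suc m)) + \<dots> = 2 * (\<Sum>m\<le>n. Pbar q n m * hermite_step q g m)"
  proof -
    have "g (Suc m) + (1 - q ^ m) * g (m - 1) = 2 * hermite_step q g m" for m
      using 2 by (simp add: hermite_step_def)
    then show ?thesis
      by (simp only: sum.distrib[symmetric] distrib_left[symmetric] sum_distrib_left mult.left_commute[of 2])
  qed
  also have "\<dots> = 2 ^ Suc n * (hermite_step q ^^ Suc n) g 0"
    unfolding Suc[symmetric] by (simp add: funpow_swap1)
  finally show ?case by simp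
qed

end

subsection \<open>The functional on Askey--Wilson polynomials\<close>

text \<open>For \<open>g m = L (H\<^sub>m)\<close> this is \<open>L p\<close>, computed without introducing the polynomials \<open>H\<^sub>m\<close>.\<close>

definition hermite_functional :: "'a::field \<Rightarrow> (nat \<Rightarrow> 'a) \<Rightarrow> 'a poly \<Rightarrow> 'a" where
  "hermite_functional q g p = (\<Sum>i\<le>degree p. coeff p i * (hermite_step q ^^ i) g 0)"

lemma hermite_functional_eq:
  assumes "degree p \<le> N"
  shows "hermite_functional q g p = (\<Sum>i\<le>N. coeff p i * (hermite_step q ^^ i) g 0)"
  unfolding hermite_functional_def by (rule sum.mono_neutral_left) (use assms in \<open>auto simp: coeff_eq_0\<close>)

lemma hermite_functional_add: "hermite_functional q g (p + r) = hermite_functional q g p + hermite_functional q g r"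
proof -
  define N where "N = max (degree p) (degree r)"
  have "degree (p + r) \<le> N" "degree p \<le> N" "degree r \<le> N"
    by (auto simp: N_def degree_add_le_max)
  then show ?thesis by (simp add: hermite_functional_eq sum.distrib algebra_simps)
qed

lemma hermite_functional_smult: "hermite_functional q g (smult k p) = k * hermite_functional q g p"
  using hermite_functional_eq[of "smult k p" "degree p"] hermite_functional_eq[of p "degree p"] degree_smult_le[of k p]
  by (simp add: sum_distrib_left mult.assoc)

lemma hermite_functional_diff: "hermite_functional q g (p - r) = hermite_functional q g p - hermite_functional q g r"
  using hermite_functional_add[of q g p "smult (- 1) r"] hermite_functional_smult[of q g "- 1" r] by simp

lemma hermite_functional_pCons_0: "hermite_functional q g (pCons 0 p) = hermite_functional q (hermite_step q g) p"
proof -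
  have "degree (pCons 0 p) \<le> Suc (degree p)" by (rule degree_pCons_le)
  from hermite_functional_eq[OF this] show ?thesis
    by (simp add: hermite_functional_def sum.atMost_Suc_shift funpow_swap1 del: sum.atMost_Suc)
qed

lemma hermite_step_lin: "hermite_step q (\<lambda>m. u * f m + v * g m) = (\<lambda>m. u * hermite_step q f m + v * hermite_step q g m)"
  by (rule ext) (simp add: hermite_step_def algebra_simps flip: add_divide_distrib)

lemma hermite_functional_lin: "hermite_functional q (\<lambda>m. u * f m + v * g m) p = u * hermite_functional q f p + v * hermite_functional q g p"
proof -
  have "(hermite_step q ^^ i) (\<lambda>m. u * f m + v * g m) = (\<lambda>m. u * (hermite_step q ^^ i) f m + v * (hermite_step q ^^ i) g m)" for i
    by (induction i) (simp_all add: hermite_step_lin)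
  then show ?thesis
    by (simp add: hermite_functional_def sum_distrib_left algebra_simps flip: sum.distrib)
qed

text \<open>With \<open>u = 1 + a^2\<close> and \<open>v = - 2 a\<close> the new sequence is the one
  evaluated by \<open>hermite_moment_contiguous\<close>.\<close>

lemma hermite_functional_linear_factor: "hermite_functional q g ([:u, v:] * p) = hermite_functional q (\<lambda>m. u * g m + v * hermite_step q g m) p"
proof -
  have "[:u, v:] * p = smult u p + pCons 0 (smult v p)" by simp
  then show ?thesis by (simp only: hermite_functional_add hermite_functional_smult hermite_functional_pCons_0 hermite_functional_lin)
qed

lemma hermite_functional_1: "hermite_functional q g 1 = g 0"
  by (simp add: hermite_functional_def)

lemma linear_hlam: "Vector_Spaces.linear smult (*) (hermite_functional q g)"
  unfolding linear_poly_iff by (simp add: hermite_functional_add hermite_functional_smult)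

lemma hermite_functional_monom: "hermite_functional q g (monom 1 n) = (hermite_step q ^^ n) g 0"
  using hermite_functional_eq[of "monom 1 n :: 'a::field poly" n q g] 
  by (simp add: degree_monom_eq if_distrib[of "\<lambda>x. x * _"] cong: if_cong)

text \<open>\<open>(ae\<^sup>i\<^sup>\<theta>)\<^sub>k (ae\<^sup>-\<^sup>i\<^sup>\<theta>)\<^sub>k\<close> as a polynomial in \<open>x = cos \<theta>\<close>.\<close>

definition aw_basis :: "'a::field \<Rightarrow> 'a \<Rightarrow> nat \<Rightarrow> 'a poly" where
  "aw_basis q a k = (\<Prod>i<k. [:1 + (a * q ^ i)\<^sup>2, - 2 * (a * q ^ i):])"

lemma aw_basis_Suc: "aw_basis q a (Suc k) = aw_basis q a k * [:1 + (a * q ^ k)\<^sup>2, - 2 * (a * q ^ k):]"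
  by (simp add: aw_basis_def)

lemma aw_basis_Suc_left: "aw_basis q a (Suc k) = [:1 + a\<^sup>2, - 2 * a:] * aw_basis q (a * q) k"
  unfolding aw_basis_def by (subst prod.lessThan_Suc_shift) (simp add: mult.assoc)

text \<open>The three-term recurrence applied to the closed form in \<open>hermite_functional_aw_poly_basis\<close>, with \<open>Q = q\<^sup>n\<close>,
  \<open>X = q\<^sup>k\<close> and all denominators cleared.\<close>

lemma aw_recurrence_identity:
  fixes a b c d q Q X :: "'a::field"
  defines "e \<equiv> a*b*c*d"
  shows "- (a^2) * X * ((1-b*c*(Q*q))*(1-b*d*(Q*q))*(1-c*d*(Q*q))*(1-e*Q))*(Q-X)*(Q*q-X)*(1-e*Q^2) =
   ((a^2*X^2 + 1 - (a^2+1)*X) * ((1-e*Q^2)*(1-e*Q^2*q)*(1-e*Q^2*q^2))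
     + X*((1-a*b*(Q*q))*(1-a*c*(Q*q))*(1-a*d*(Q*q))*(1-e*Q))*(1-e*Q^2)
     + a^2*X*((1-Q*q)*(1-b*c*Q)*(1-b*d*Q)*(1-c*d*Q))*(1-e*Q^2*q^2)) * (1-e*X*Q*q)*(Q-X)
   - ((1-a*b*X)*(1-a*c*X)*(1-a*d*X))*(1-q*X)*Q*((1-e*Q^2)*(1-e*Q^2*q)*(1-e*Q^2*q^2))
   + X*((1-a*b*Q)*(1-a*c*Q)*(1-a*d*Q)*(1-Q*q))*(1-e*X*Q)*(1-e*X*Q*q)*(1-e*Q^2*q^2)"
  unfolding e_def by algebra

text \<open>\<open>A\<close>, \<open>C\<close>, \<open>B\<close> are \<open>A_(n+1)\<close>,
  \<open>C_(n+1)\<close>, \<open>b_(n+1)\<close>, and \<open>k\<close> is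
  \<open>aw_norm_ratio\<close> at \<open>n + 1\<close>. \<open>l\<close> is
  \<open>lambda_(n+1)\<close> divided by \<open>aw_norm_ratio\<close> at \<open>n\<close>, which
  removes the factor that is special at \<open>n = 0\<close>.\<close>

lemma aw_recurrence_step:
  fixes a b c d q Q X A C B l k :: "'a::field"
  defines "e \<equiv> a*b*c*d"
  assumes nz: "a \<noteq> 0" "X \<noteq> 0" "(2::'a) \<noteq> 0" "1-e*Q^2 \<noteq> 0" "1-e*Q^2*q \<noteq> 0" "1-e*Q^2*q^2 \<noteq> 0"
  assumes A: "A = (1-a*b*(Q*q))*(1-a*c*(Q*q))*(1-a*d*(Q*q))*(1-e*Q) / (a*(1-e*Q^2*q)*(1-e*Q^2*q^2))"
    and C: "C = a*((1-Q*q)*(1-b*c*Q)*(1-b*d*Q)*(1-c*d*Q)) / ((1-e*Q^2)*(1-e*Q^2*q))"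
    and B: "B = (a + inverse a - (A + C)) / 2"
    and l: "l = - ((1-a*b*Q)*(1-a*c*Q)*(1-a*d*Q)*(1-Q*q)) / (2*a*(1-e*Q^2)*(1-e*Q^2*q))"
    and k: "k = - a*((1-b*c*(Q*q))*(1-b*d*(Q*q))*(1-c*d*(Q*q))*(1-e*Q)) / (2*(1-e*Q^2*q)*(1-e*Q^2*q^2))"
  shows "((1+(a*X)^2) / (2*(a*X)) - B) * ((1-e*X*Q*q)*(Q-X))
      - ((1-a*b*X)*(1-a*c*X)*(1-a*d*X))*(1-q*X)*Q / (2*(a*X)) - l*((1-e*X*Q)*(1-e*X*Q*q))
    = k*((Q-X)*(Q*q-X))"
proof -
  define D1 where "D1 = 1-e*Q^2"
  define D2 where "D2 = 1-e*Q^2*q"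
  define D3 where "D3 = 1-e*Q^2*q^2"
  define NA where "NA = (1-a*b*(Q*q))*(1-a*c*(Q*q))*(1-a*d*(Q*q))*(1-e*Q)"
  define NC where "NC = (1-Q*q)*(1-b*c*Q)*(1-b*d*Q)*(1-c*d*Q)"
  define Nl where "Nl = (1-a*b*Q)*(1-a*c*Q)*(1-a*d*Q)*(1-Q*q)"
  define Nk where "Nk = (1-b*c*(Q*q))*(1-b*d*(Q*q))*(1-c*d*(Q*q))*(1-e*Q)"
  define t where "t = (1-a*b*X)*(1-a*c*X)*(1-a*d*X)"
  define u where "u = 1 - e*X*Q"
  define v where "v = 1 - e*X*Q*q"
  define i where "i = inverse (2*(a*X))"
  have i: "i*(2*(a*X)) = 1" unfolding i_def by (rule left_inverse) (use nz in simp)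
  have A': "A*(a*D2*D3) = NA" and C': "C*(D1*D2) = a*NC" and l': "l*(2*a*D1*D2) = - Nl"
    and k': "k*(2*D2*D3) = - a*Nk" and B': "2*a*B = a^2+1-a*(A+C)"
    unfolding A C l k B NA_def[symmetric] NC_def[symmetric] Nl_def[symmetric] Nk_def[symmetric]
      D1_def[symmetric] D2_def[symmetric] D3_def[symmetric]
    using nz unfolding D1_def[symmetric] D2_def[symmetric] D3_def[symmetric]
    by (simp_all add: field_simps power2_eq_square)
  have P: "- (a^2)*X*Nk*(Q-X)*(Q*q-X)*D1 = ((a^2*X^2+1-(a^2+1)*X)*(D1*D2*D3) + X*NA*D1 + a^2*X*NC*D3)*v*(Q-X)
     - t*(1-q*X)*Q*(D1*D2*D3) + X*Nl*u*v*D3"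
    unfolding D1_def D2_def D3_def NA_def NC_def Nl_def Nk_def t_def u_def v_def e_def by (rule aw_recurrence_identity)
  \<comment> \<open>This one factor clears all denominators and leads to \<open>P\<close>.\<close>
  have "(2*a*X*D1*D2*D3) * (((1+(a*X)^2)*i - B)*(v*(Q-X)) - t*(1-q*X)*Q*i - l*(u*v))
     = (2*a*X*D1*D2*D3) * (k*((Q-X)*(Q*q-X)))"
  proof -
    have "(2*a*X*D1*D2*D3) * (((1+(a*X)^2)*i - B)*(v*(Q-X)) - t*(1-q*X)*Q*i - l*(u*v))
      = ((1+(a*X)^2)*(i*(2*(a*X))) * (D1*D2*D3) - X*(2*a*B)*(D1*D2*D3))*(v*(Q-X))
        - t*(1-q*X)*Q*(D1*D2*D3)*(i*(2*(a*X))) - (l*(2*a*D1*D2))*X*D3*(u*v)"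
      by algebra
    also have "\<dots> = ((1+(a*X)^2)* (D1*D2*D3) - X*(a^2+1)*(D1*D2*D3) + X*D1*(A*(a*D2*D3)) + X*a*D3*(C*(D1*D2)))*(v*(Q-X))
        - t*(1-q*X)*Q*(D1*D2*D3) + Nl*X*D3*(u*v)"
      unfolding i B' l' by algebra
    also have "\<dots> = - (a^2)*X*Nk*(Q-X)*(Q*q-X)*D1"
      unfolding A' C' P by algebra
    also have "\<dots> = (k*(2*D2*D3))*a*X*(Q-X)*(Q*q-X)*D1"
      unfolding k' by algebra
    also have "\<dots> = (2*a*X*D1*D2*D3) * (k*((Q-X)*(Q*q-X)))"
      by algebra
    finally show ?thesis .
  qed
  moreover have "2*a*X*D1*D2*D3 \<noteq> 0"
    using nz by (simp add: D1_def D2_def D3_def)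
  ultimately have "((1+(a*X)^2)*i - B)*(v*(Q-X)) - t*(1-q*X)*Q*i - l*(u*v) = k*((Q-X)*(Q*q-X))"
    by (metis mult_left_cancel)
  then show ?thesis
    by (simp only: i_def t_def u_def v_def divide_inverse)
qed

text \<open>The step from \<open>P_0\<close> to \<open>P_1\<close> stands apart: it has no
  \<open>lambda\<close> term and contains \<open>A_0\<close> in its cancelled form.\<close>

lemma aw_recurrence_step_0:
  fixes a b c d X B k :: "'a::field"
  defines "e \<equiv> a*b*c*d"
  assumes nz: "a \<noteq> 0" "X \<noteq> 0" "(2::'a) \<noteq> 0" "1-e \<noteq> 0"
  assumes B: "B = (a + inverse a - (1-a*b)*(1-a*c)*(1-a*d) / (a*(1-e))) / 2"
    and k: "k = - a*((1-b*c)*(1-b*d)*(1-c*d)) / (2*(1-e))"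
  shows "((1+(a*X)^2) / (2*(a*X)) - B) * (1-e*X)
      - ((1-a*b*X)*(1-a*c*X)*(1-a*d*X)) / (2*(a*X)) = k*(1-X)"
proof -
  define D1 where "D1 = 1-e"
  define NA where "NA = (1-a*b)*(1-a*c)*(1-a*d)"
  define Nk where "Nk = (1-b*c)*(1-b*d)*(1-c*d)"
  define t where "t = (1-a*b*X)*(1-a*c*X)*(1-a*d*X)"
  define u where "u = 1 - e*X"
  define i where "i = inverse (2*(a*X))"
  have i: "i*(2*(a*X)) = 1" unfolding i_def by (rule left_inverse) (use nz in simp)
  have k': "k*(2*D1) = - a*Nk" and B': "2*a*B*D1 = (a^2+1)*D1-NA"
    unfolding k B NA_def[symmetric] Nk_def[symmetric] D1_def[symmetric]
    using nz unfolding D1_def[symmetric]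
    by (simp_all add: field_simps power2_eq_square)
  have P: "((1+(a*X)^2)*D1 - X*((a^2+1)*D1 - NA))*u - t*D1 = - (a^2)*X*Nk*(1-X)"
    unfolding D1_def NA_def Nk_def t_def u_def e_def by algebra
  have "(2*a*X*D1) * (((1+(a*X)^2)*i - B)*u - t*i)
      = ((1+(a*X)^2)*D1*(i*(2*(a*X))) - X*(2*a*B*D1))*u - t*D1*(i*(2*(a*X)))"
    by algebra
  also have "\<dots> = - (a^2)*X*Nk*(1-X)"
    unfolding i B' using P by simp
  also have "\<dots> = (k*(2*D1))*a*X*(1-X)"
    unfolding k' by algebra
  also have "\<dots> = (2*a*X*D1) * (k*(1-X))"
    by algebra
  finally have "(2*a*X*D1) * (((1+(a*X)^2)*i - B)*u - t*i) = (2*a*X*D1) * (k*(1-X))" .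
  moreover have "2*a*X*D1 \<noteq> 0"
    using nz by (simp add: D1_def)
  ultimately have "((1+(a*X)^2)*i - B)*u - t*i = k*(1-X)"
    by (metis mult_left_cancel)
  then show ?thesis
    by (simp only: i_def t_def u_def divide_inverse)
qed

text \<open>The ratio of the constants in \<open>hermite_functional_aw_poly_basis\<close> for \<open>i + 1\<close> and \<open>i\<close>; as in \<^const>\<open>aw_A\<close>, the
  factor \<open>1 - abcd/q\<close> is cancelled at \<open>i = 0\<close>.\<close>

definition aw_norm_ratio :: "'a::field \<Rightarrow> 'a \<Rightarrow> 'a \<Rightarrow> 'a \<Rightarrow> 'a \<Rightarrow> nat \<Rightarrow> 'a" where
  "aw_norm_ratio q a b c d i = - a * ((1 - b*c*q^i) * (1 - b*d*q^i) * (1 - c*d*q^i))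
     * (if i = 0 then 1 else (1 - a*b*c*d*q^(i-1)) / (1 - a*b*c*d*q^(2*i-1))) / (2 * (1 - a*b*c*d*q^(2*i)))"

section \<open>Values of the functional on \<open>P_n\<close> times the basis\<close>

context
  fixes q :: "'a::field"
  assumes q: "\<And>j::nat. j \<ge> 1 \<Longrightarrow> q ^ j \<noteq> 1" and two: "(2::'a) \<noteq> 0"
begin

lemma hermite_functional_hmoment_factor:
  assumes "\<And>j::nat. a * b * c * d * q ^ j \<noteq> 1"
  shows "hermite_functional q (hermite_moment q a b c d) ([:1 + a\<^sup>2, - 2 * a:] * p)
    = (1 - a * b) * (1 - a * c) * (1 - a * d) / (1 - a * b * c * d) * hermite_functional q (hermite_moment q (a * q) b c d) p"
proof -
  define k where "k = (1 - a * b) * (1 - a * c) * (1 - a * d) / (1 - a * b * c * d)"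
  let ?h = "hermite_moment q a b c d" and ?h' = "hermite_moment q (a * q) b c d"
  have "(1 + a\<^sup>2) * ?h m + - 2 * a * hermite_step q ?h m = k * ?h' m + 0 * ?h' m" for m
    using hermite_moment_contiguous[OF q assms two, of m] by (simp add: k_def)
  then have "hermite_functional q ?h ([:1 + a\<^sup>2, - 2 * a:] * p) = hermite_functional q (\<lambda>m. k * ?h' m + 0 * ?h' m) p"
    unfolding hermite_functional_linear_factor by presburger
  then show ?thesis unfolding hermite_functional_lin by (simp add: k_def)
qed

text \<open>Removing the first basis factor replaces \<open>a\<close> by \<open>a q\<close>, so the
  induction runs over all \<open>a\<close> and the constants build up the Pochhammer
  symbols.\<close>

lemma hermite_functional_aw_basis:
  assumes "\<And>j::nat. a * b * c * d * q ^ j \<noteq> 1"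
  shows "hermite_functional q (hermite_moment q a b c d) (aw_basis q a k)
    = qpoch q (a * b) k * qpoch q (a * c) k * qpoch q (a * d) k / qpoch q (a * b * c * d) k"
  using assms
proof (induction k arbitrary: a)
  case 0
  then show ?case by (simp add: aw_basis_def hermite_functional_1)
next
  case (Suc k)
  have "a * q * b * c * d * q ^ j \<noteq> 1" for j
    using Suc.prems[of "Suc j"] by (simp add: mult_ac)
  moreover have "a * q * b = a * b * q" "a * q * c = a * c * q" "a * q * d = a * d * q"
    "a * b * q * c * d = a * b * c * d * q"
    by (simp_all add: mult_ac)
  ultimately show ?case
    unfolding aw_basis_Suc_left hermite_functional_hmoment_factor[OF Suc.prems]
    using Suc.IH[of "a * q"] by (simp add: qpoch_Suc_left mult_ac)
qed

text \<open>For \<open>z = a q^k\<close>, \<open>x - B\<close> is a combination of 1 and the next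
  basis factor \<open>1 + z^2 - 2zx\<close>; multiplication by \<open>x\<close> thus becomes a step
  from \<open>k\<close> to \<open>k + 1\<close>.\<close>

lemma hermite_functional_recurrence:
  assumes "a \<noteq> 0" "q \<noteq> 0"
  shows "hermite_functional q g ([:- B, 1:] * P * aw_basis q a k)
    = ((1 + (a * q^k)\<^sup>2) / (2 * (a * q^k)) - B) * hermite_functional q g (P * aw_basis q a k)
      - hermite_functional q g (P * aw_basis q a (Suc k)) / (2 * (a * q^k))"
proof -
  define z where "z = a * q ^ k"
  have z: "2 * z \<noteq> 0" using assms two by (simp add: z_def)
  have "[:- B, 1:] = smult ((1 + z\<^sup>2) / (2 * z) - B) 1 - smult (1 / (2 * z)) [:1 + z\<^sup>2, - 2 * z:]"
  proof -
    have "(4::'a) = 2 * 2" by simp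
    then have "(4::'a) \<noteq> 0" using two by (metis mult_eq_0_iff)
    then show ?thesis using z by (simp add: field_simps)
  qed
  then have "[:- B, 1:] * P * aw_basis q a k
    = smult ((1 + z\<^sup>2) / (2 * z) - B) (P * aw_basis q a k) - smult (1 / (2 * z)) (P * aw_basis q a (Suc k))"
  proof -
    have "(smult r 1 - smult s L) * P * W = smult r (P * W) - smult s (P * (W * L))" for r s L and W :: "'a poly"
      by (simp only: left_diff_distrib mult_smult_left mult_1) (simp only: mult_ac)
    then show ?thesis
      unfolding aw_basis_Suc z_def[symmetric] using \<open>[:- B, 1:] = _\<close> by (simp only:)
  qed
  then show ?thesis
    by (simp only: hermite_functional_diff hermite_functional_smult z_def) simp
qed

text \<open>The last product vanishes for \<open>k < n\<close>, which is orthogonality to all lower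
  degrees. The induction must keep \<open>k\<close> arbitrary, since \<open>P_(n+1)\<close> at
  \<open>k\<close> involves \<open>P_n\<close> at \<open>k + 1\<close>.\<close>

lemma hermite_functional_aw_poly_basis:
  assumes a: "a \<noteq> 0" and q0: "q \<noteq> 0" and e: "\<And>j::nat. a * b * c * d * q ^ j \<noteq> 1"
  shows "hermite_functional q (hermite_moment q a b c d) (aw_poly a b c d q n * aw_basis q a k)
    = (\<Prod>i<n. aw_norm_ratio q a b c d i) * (qpoch q (a * b) k * qpoch q (a * c) k * qpoch q (a * d) k)
        / qpoch q (a * b * c * d) (k + n) * (\<Prod>i<n. q ^ i - q ^ k)"
proof (induction n arbitrary: k rule: induct_nat_012)
  case 0
  then show ?case using hermite_functional_aw_basis[OF e] by simp
next
  case 1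
  define X where "X = q ^ k"
  define T where "T = qpoch q (a * b) k * qpoch q (a * c) k * qpoch q (a * d) k"
  define E where "E = qpoch q (a * b * c * d) k"
  define t where "t = (1-a*b*X)*(1-a*c*X)*(1-a*d*X)"
  define u where "u = 1 - a*b*c*d*X"
  have X: "X \<noteq> 0" and u: "u \<noteq> 0" and E: "E \<noteq> 0" and e0: "1 - a*b*c*d \<noteq> 0"
    using q0 e[of k] e[of 0] qpoch_nonzero[OF e] by (auto simp: X_def u_def E_def)
  have F0: "hermite_functional q (hermite_moment q a b c d) (aw_basis q a k) = T / E"
    unfolding hermite_functional_aw_basis[OF e] T_def E_def ..
  have F1: "hermite_functional q (hermite_moment q a b c d) (aw_basis q a (Suc k)) = T * t / (E * u)"
    unfolding hermite_functional_aw_basis[OF e] T_def E_def by (simp add: qpoch_Suc t_def u_def X_def mult_ac)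
  have "hermite_functional q (hermite_moment q a b c d) (aw_poly a b c d q (Suc 0) * aw_basis q a k)
    = ((1 + (a * X)\<^sup>2) / (2 * (a * X)) - aw_b a b c d q 0) * (T / E) - T * t / (E * u) / (2 * (a * X))"
    using hermite_functional_recurrence[OF a q0, of "hermite_moment q a b c d" "aw_b a b c d q 0" 1 k]
    by (simp only: aw_poly.simps mult_1 mult_1_right F0 F1 X_def)
  also have "\<dots> = (((1 + (a * X)\<^sup>2) / (2 * (a * X)) - aw_b a b c d q 0) * u - t / (2 * (a * X))) * (T / (E * u))"
  proof -
    have "T / E = u * (T / (E * u))" using u by simp
    moreover have "T * t / (E * u) = t * (T / (E * u))" by simp
    ultimately show ?thesis
      by (simp only: left_diff_distrib times_divide_eq_left mult.assoc)
  qed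
  also have "((1 + (a * X)\<^sup>2) / (2 * (a * X)) - aw_b a b c d q 0) * u - t / (2 * (a * X)) = aw_norm_ratio q a b c d 0 * (1 - X)"
    unfolding t_def u_def
    by (rule aw_recurrence_step_0[OF a X two e0]) (simp_all add: aw_b_def aw_A_def aw_C_def aw_norm_ratio_def)
  finally show ?case
    by (simp add: T_def E_def u_def X_def qpoch_Suc)
next
  case (ge2 n)
  define X where "X = q ^ k"
  define Q where "Q = q ^ n"
  define f where "f = a * b * c * d"
  define T where "T = qpoch q (a * b) k * qpoch q (a * c) k * qpoch q (a * d) k"
  define t where "t = (1-a*b*X)*(1-a*c*X)*(1-a*d*X)"
  define u where "u = 1 - f*X*Q"
  define v where "v = 1 - f*X*Q*q"
  define N where "N = (\<Prod>i<n. aw_norm_ratio q a b c d i)"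
  define R where "R = (\<Prod>i<n. q ^ i - q ^ k)"
  define E where "E = qpoch q f (k + n)"
  \<comment> \<open>The three values in the recurrence have denominators
    \<open>(abcd)_(k+n)\<close>, \<open>(abcd)_(k+n+1)\<close> and \<open>(abcd)_(k+n+2)\<close>;
    \<open>E * u * v\<close> is the last, so all three are multiples of \<open>V\<close>.\<close>
  define V where "V = N * T / (E * u * v) * R"
  define k0 where "k0 = aw_norm_ratio q a b c d n"
  define k1 where "k1 = aw_norm_ratio q a b c d (Suc n)"
  define l where "l = - ((1-a*b*Q)*(1-a*c*Q)*(1-a*d*Q)*(1-Q*q)) / (2*a*(1-f*Q^2)*(1-f*Q^2*q))"
  define B where "B = aw_b a b c d q (Suc n)"
  have X: "X \<noteq> 0" using q0 by (simp add: X_def)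
  have u: "u \<noteq> 0" and v: "v \<noteq> 0" and E: "E \<noteq> 0"
    using e[of "k + n"] e[of "Suc (k + n)"] qpoch_nonzero[OF e]
    by (auto simp: u_def v_def X_def Q_def f_def E_def power_add mult_ac)
  have D: "1 - f*Q^2 \<noteq> 0" "1 - f*Q^2*q \<noteq> 0" "1 - f*Q^2*q^2 \<noteq> 0"
    using e[of "2 * n"] e[of "2 * n + 1"] e[of "2 * n + 2"]
    by (auto simp: f_def Q_def power_add power_mult power2_eq_square mult_ac power_mult_distrib)
  have F0: "hermite_functional q (hermite_moment q a b c d) (aw_poly a b c d q n * aw_basis q a k) = V * (u * v)"
    using ge2(1)[of k] u v by (simp add: V_def N_def T_def E_def R_def f_def)
  have F1: "hermite_functional q (hermite_moment q a b c d) (aw_poly a b c d q (Suc n) * aw_basis q a k) = k0 * V * (v * (Q - X))"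
    using ge2(2)[of k] v
    by (simp add: V_def N_def T_def E_def R_def f_def k0_def X_def Q_def qpoch_Suc u_def power_add mult_ac)
  \<comment> \<open>At \<open>k + 1\<close> the product is reindexed: each of \<open>n\<close>
    factors gives up a \<open>q\<close>, and the factor at \<open>i = 0\<close> is new.\<close>
  have "(\<Prod>i<n. q ^ Suc i - q ^ Suc k) = Q * R"
  proof -
    have "(\<Prod>i<n. q ^ Suc i - q ^ Suc k) = (\<Prod>i<n. q * (q ^ i - q ^ k))"
      by (simp add: right_diff_distrib)
    then show ?thesis by (simp add: prod.distrib Q_def R_def)
  qed
  then have "(\<Prod>i<Suc n. q ^ i - q ^ Suc k) = (1 - q * X) * (Q * R)"
    unfolding prod.lessThan_Suc_shift by (simp add: X_def)
  then have F2: "hermite_functional q (hermite_moment q a b c d) (aw_poly a b c d q (Suc n) * aw_basis q a (Suc k)) = k0 * V * (t * (1 - q * X) * Q)"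
    using ge2(2)[of "Suc k"]
    by (simp add: V_def N_def T_def E_def f_def k0_def qpoch_Suc t_def u_def v_def X_def Q_def power_add mult_ac)
  \<comment> \<open>The factor with a special value at \<open>n = 0\<close>; \<open>A_n\<close> and
    \<open>k0\<close> share it.\<close>
  define g where "g = (if n = 0 then 1 else (1 - f*q^(n-1)) / (1 - f*q^(2*n-1)))"
  define NA where "NA = (1-a*b*Q)*(1-a*c*Q)*(1-a*d*Q)"
  define NB where "NB = (1-b*c*Q)*(1-b*d*Q)*(1-c*d*Q)"
  have p: "q ^ (Suc n - 1) = Q" "q ^ Suc n = Q * q" "q ^ (2 * Suc n - 2) = Q^2"
    "q ^ (2 * Suc n - 1) = Q^2 * q" "q ^ (2 * Suc n) = Q^2 * q^2" "q ^ (2 * n) = Q^2"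
  proof -
    have "2 * Suc n - 2 = 2 * n" "2 * Suc n - 1 = Suc (2 * n)" "2 * Suc n = Suc (Suc (2 * n))"
      "q ^ (2 * n) = Q^2"
      by (simp_all add: Q_def mult.commute flip: power_mult)
    then show "q ^ (Suc n - 1) = Q" "q ^ Suc n = Q * q" "q ^ (2 * Suc n - 2) = Q^2"
    "q ^ (2 * Suc n - 1) = Q^2 * q" "q ^ (2 * Suc n) = Q^2 * q^2" "q ^ (2 * n) = Q^2"
      by (simp_all only: power_Suc diff_Suc_1 Q_def) (simp_all add: power2_eq_square)
  qed
  have C: "aw_C a b c d q (Suc n) = a*((1-Q*q)*(1-b*c*Q)*(1-b*d*Q)*(1-c*d*Q)) / ((1-f*Q^2)*(1-f*Q^2*q))"
    by (simp only: aw_C_def p nat.distinct if_False f_def mult.assoc)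
  have A: "aw_A a b c d q (Suc n) = (1-a*b*(Q*q))*(1-a*c*(Q*q))*(1-a*d*(Q*q))*(1-f*Q) / (a*(1-f*Q^2*q)*(1-f*Q^2*q^2))"
    by (simp only: aw_A_def p nat.distinct if_False f_def mult.assoc)
  have A0: "aw_A a b c d q n = NA * g / (a*(1-f*Q^2))"
    by (simp add: aw_A_def f_def p NA_def g_def mult.assoc) (simp add: Q_def mult_ac)
  have k0: "k0 = - a * NB * g / (2*(1-f*Q^2))"
    by (simp only: k0_def aw_norm_ratio_def f_def p(6) Q_def[symmetric] NB_def g_def)
  have k1: "k1 = - a*((1-b*c*(Q*q))*(1-b*d*(Q*q))*(1-c*d*(Q*q))*(1-f*Q)) / (2*(1-f*Q^2*q)*(1-f*Q^2*q^2))"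
    by (simp only: k1_def aw_norm_ratio_def p nat.distinct if_False f_def mult.assoc times_divide_eq_left
      times_divide_eq_right divide_divide_eq_left mult.left_commute[of 2])
  have l: "aw_lambda a b c d q (Suc n) = k0 * l"
  proof -
    have "NA * g / (a * D) * (a * (r * NB) / (D * D')) / 4 = - a * NB * g / (2 * D) * (- (NA * r) / (2 * a * D * D'))"
      for r D D' using a by (simp add: field_simps)
    then show ?thesis
      by (simp add: aw_lambda_def A0 C k0 l_def NA_def[symmetric]) (simp add: NB_def mult_ac)
  qed
  have "hermite_functional q (hermite_moment q a b c d) (aw_poly a b c d q (Suc (Suc n)) * aw_basis q a k)
     = ((1+(a*X)^2) / (2*(a*X)) - B) * (k0 * V * (v * (Q - X))) - k0 * V * (t * (1 - q * X) * Q) / (2*(a*X)) - k0 * l * (V * (u * v))"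
    by (simp only: aw_poly.simps left_diff_distrib[of _ _ "aw_basis _ _ _"] mult_smult_left hermite_functional_diff hermite_functional_smult 
       hermite_functional_recurrence[OF a q0] F0 F1 F2 l B_def[symmetric] X_def[symmetric])
  also have "\<dots> = k0 * V * (((1+(a*X)^2) / (2*(a*X)) - B) * (v*(Q-X)) - t*(1-q*X)*Q / (2*(a*X)) - l*(u*v))"
    by (simp add: algebra_simps)
  also have "((1+(a*X)^2) / (2*(a*X)) - B) * (v*(Q-X)) - t*(1-q*X)*Q / (2*(a*X)) - l*(u*v) = k1*((Q-X)*(Q*q-X))"
    unfolding t_def u_def v_def f_def
    by (rule aw_recurrence_step[OF a X two D[unfolded f_def] A[unfolded f_def] C[unfolded f_def] _ l_def[unfolded f_def] k1[unfolded f_def]])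
      (simp add: B_def aw_b_def)
  finally show ?case
    by (simp add: V_def N_def R_def T_def E_def k0_def k1_def u_def v_def f_def X_def Q_def qpoch_Suc power_add mult_ac)
qed

end

section \<open>Expansion of the moments as a fourfold sum\<close>

text \<open>As \<open>w\<close> vanishes beyond \<open>n\<close>, the triangle
  \<open>i + j \<le> n\<close> may be enlarged to a square. The inner sum is again weighted, so
  further factors can be split off.\<close>

lemma sum_weighted_fps_mult:
  fixes F G :: "'a::field fps"
  assumes "\<And>m. m > n \<Longrightarrow> w m = 0"
  shows "(\<Sum>m\<le>n. w m * (F * G) $ m) = (\<Sum>i\<le>n. F $ i * (\<Sum>j\<le>n. w (i + j) * G $ j))"
proof -
  have w: "m \<le> n" if "w m \<noteq> 0" for m
    using assms[of m] that by (auto simp: not_le[symmetric])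
  have "(\<Sum>m\<le>n. w m * (F * G) $ m) = (\<Sum>m\<le>n. \<Sum>i\<le>m. w (i + (m - i)) * (F $ i * G $ (m - i)))"
    by (simp add: fps_mult_nth atLeast0AtMost sum_distrib_left)
  also have "\<dots> = (\<Sum>(i, j) | i + j \<le> n. w (i + j) * (F $ i * G $ j))"
    by (rule sum.triangle_reindex_eq[symmetric])
  also have "\<dots> = (\<Sum>(i, j) \<in> {..n} \<times> {..n}. w (i + j) * (F $ i * G $ j))"
    by (rule sum.mono_neutral_left) (auto intro: w)
  finally show ?thesis
    by (simp add: sum.cartesian_product[symmetric] sum_distrib_left mult_ac)
qed

theorem theorem5p2:
  fixes a b c d q :: "'a::field_char_0" and n :: nat
  assumes "a \<noteq> 0" and "q \<noteq> 0"
    and "\<And>j::nat. j \<ge> 1 \<Longrightarrow> q ^ j \<noteq> 1"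
    and "\<And>j::nat. a * b * c * d * q ^ j \<noteq> 1"
  shows "2 ^ n * aw_moment a b c d q n =
    (\<Sum>\<alpha>\<le>n. \<Sum>\<beta>\<le>n. \<Sum>\<gamma>\<le>n. \<Sum>\<delta>\<le>n.
       a ^ \<alpha> * b ^ \<beta> * c ^ \<gamma> * d ^ \<delta> * Pbar q n (\<alpha> + \<beta> + \<gamma> + \<delta>)
       * qmultinom4 q \<alpha> \<beta> \<gamma> \<delta>
       * (qpoch q (a * d) (\<beta> + \<gamma>) * qpoch q (a * c) \<beta> * qpoch q (b * d) \<gamma>
          / qpoch q (a * b * c * d) (\<beta> + \<gamma>)))"
proof -
  note q = assms(3) and e = assms(4)
  let ?h = "hermite_moment q a b c d"
  have two: "(2::'a) \<noteq> 0" by simp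
  have "hermite_functional q ?h (aw_poly a b c d q m) = 0" if "m \<ge> 1" for m
  proof -
    \<comment> \<open>At \<open>k = 0\<close> the basis polynomial is 1 and the factor at
      \<open>i = 0\<close> is zero.\<close>
    have "(\<Prod>i<m. q ^ i - q ^ 0) = 0" using that by (intro prod_zero bexI[of _ 0]) auto
    then show ?thesis
      using hermite_functional_aw_poly_basis[OF q two assms(1,2) e, of m 0] by (simp add: aw_basis_def)
  qed
  then have "is_aw_functional a b c d q (hermite_functional q ?h)"
    by (simp add: is_aw_functional_def linear_hlam hermite_functional_1)
  then have "aw_functional a b c d q = hermite_functional q ?h"
    unfolding aw_functional_def by (intro the1_equality ex1_aw_functional)
  then have "2 ^ n * aw_moment a b c d q n = (\<Sum>m\<le>n. Pbar q n m * ?h m)"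
    by (simp add: aw_moment_def hermite_functional_monom Pbar_hstep[OF q two])
  \<comment> \<open>With \<open>(q)_m\<close> in the weight, the four denominators of the series
    complete it to the \<open>q\<close>-multinomial.\<close>
  also have "\<dots> = (\<Sum>m\<le>n. (Pbar q n m * qpoch q q m) * hermite_series q a b c d $ m)"
    by (simp add: hermite_moment_def mult.assoc)
  also have "\<dots> = (\<Sum>\<alpha>\<le>n. \<Sum>\<delta>\<le>n. \<Sum>\<beta>\<le>n. \<Sum>\<gamma>\<le>n.
       a ^ \<alpha> * b ^ \<beta> * c ^ \<gamma> * d ^ \<delta> * Pbar q n (\<alpha> + \<beta> + \<gamma> + \<delta>)
       * qmultinom4 q \<alpha> \<beta> \<gamma> \<delta>
       * (qpoch q (a * d) (\<beta> + \<gamma>) * qpoch q (a * c) \<beta> * qpoch q (b * d) \<gamma>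
          / qpoch q (a * b * c * d) (\<beta> + \<gamma>)))"
  proof -
    define w where "w m = Pbar q n m * qpoch q q m" for m
    define r where "r m = qpoch q (a * d) m / qpoch q (a * b * c * d) m" for m
    have w: "w m = 0" if "m > n" for m
      using that by (simp add: w_def Pbar_eq_0[OF q])
    have "(\<Sum>m\<le>n. w m * hermite_series q a b c d $ m)
      = (\<Sum>\<alpha>\<le>n. fps_dil a (qexp q) $ \<alpha> * (\<Sum>\<delta>\<le>n. fps_dil d (qexp q) $ \<delta>
           * (\<Sum>j\<le>n. w (\<alpha> + (\<delta> + j)) * abcd_series q a b c d $ j)))"
      unfolding hermite_series_def by (simp add: sum_weighted_fps_mult w)
    \<comment> \<open>The coefficientwise factor \<open>r j\<close> joins the weight, leaving the
      genuine product \<open>bc_series\<close> to be split.\<close>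
    also have "\<dots> = (\<Sum>\<alpha>\<le>n. fps_dil a (qexp q) $ \<alpha> * (\<Sum>\<delta>\<le>n. fps_dil d (qexp q) $ \<delta>
           * (\<Sum>j\<le>n. (w (\<alpha> + (\<delta> + j)) * r j) * bc_series q a b c d $ j)))"
      by (simp add: abcd_series_def r_def mult.assoc)
    also have "\<dots> = (\<Sum>\<alpha>\<le>n. fps_dil a (qexp q) $ \<alpha> * (\<Sum>\<delta>\<le>n. fps_dil d (qexp q) $ \<delta>
           * (\<Sum>\<beta>\<le>n. fps_dil b (qbin_fps q (a * c)) $ \<beta>
             * (\<Sum>\<gamma>\<le>n. w (\<alpha> + (\<delta> + (\<beta> + \<gamma>))) * r (\<beta> + \<gamma>) * fps_dil c (qbin_fps q (b * d)) $ \<gamma>))))"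
      unfolding bc_series_def by (subst sum_weighted_fps_mult) (simp_all add: w)
    finally show ?thesis
      unfolding w_def r_def sum_distrib_left
      by (simp add: qexp_def qbin_fps_def qmultinom4_def mult_ac add_ac)
  qed
  also have "\<dots> = (\<Sum>\<alpha>\<le>n. \<Sum>\<beta>\<le>n. \<Sum>\<gamma>\<le>n. \<Sum>\<delta>\<le>n.
       a ^ \<alpha> * b ^ \<beta> * c ^ \<gamma> * d ^ \<delta> * Pbar q n (\<alpha> + \<beta> + \<gamma> + \<delta>)
       * qmultinom4 q \<alpha> \<beta> \<gamma> \<delta>
       * (qpoch q (a * d) (\<beta> + \<gamma>) * qpoch q (a * c) \<beta> * qpoch q (b * d) \<gamma>
          / qpoch q (a * b * c * d) (\<beta> + \<gamma>)))"
    by (rule sum.cong[OF refl], subst sum.swap, rule sum.cong[OF refl], rule sum.swap)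
  finally show ?thesis .
qed

end
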